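(* Let $M$ be a $\sigma$-finite factor not isomorphic to $\mathbb{C}$ with strictly homogeneous state space. Then the predual $M_*$ is not separable.
   Context: A $\sigma$-finite von Neumann algebra $M$ has strictly homogeneous state space if for any two normal faithful states $\varphi,\psi$ on $M$ there is a unitary $u\in M$ such that $u\varphi u^*=\psi$, where $(u\varphi u^* )(x)=\varphi(u^*xu)$. *)

theory Defs
  imports "HOL-Analysis.Analysis"
begin

text \<open>Complex Hilbert spaces. The inner product is conjugate-linear in its first argument;
  completeness is inherited from \<^class>\<open>banach\<close>. No separability is assumed.\<close>

class chilbert_space = banach +
  fixes scaleC :: "complex \<Rightarrow> 'a \<Rightarrow> 'a"  (infixr "*\<^sub>C" 75)
    and cinner :: "'a \<Rightarrow> 'a \<Rightarrow> complex"
  assumes scaleC_add_right: "a *\<^sub>C (x + y) = a *\<^sub>C x + a *\<^sub>C y"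
    and scaleC_add_left: "(a + b) *\<^sub>C x = a *\<^sub>C x + b *\<^sub>C x"
    and scaleC_scaleC: "a *\<^sub>C b *\<^sub>C x = (a * b) *\<^sub>C x"
    and scaleC_of_real: "complex_of_real r *\<^sub>C x = r *\<^sub>R x"
    and cinner_commute: "cinner x y = cnj (cinner y x)"
    and cinner_add_right: "cinner x (y + z) = cinner x y + cinner x z"
    and cinner_scaleC_right: "cinner x (a *\<^sub>C y) = a * cinner x y"
    and cinner_self: "cinner x x = complex_of_real ((norm x)\<^sup>2)"

lemma norm_scaleC: "norm (c *\<^sub>C x) = cmod c * norm (x :: 'h::chilbert_space)"
proof -
  have "cinner (c *\<^sub>C x) (c *\<^sub>C x) = c * cnj c * cinner x x"
    by (metis cinner_commute cinner_scaleC_right complex_cnj_mult mult.assoc)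
  then have "complex_of_real ((norm (c *\<^sub>C x))\<^sup>2) = complex_of_real ((cmod c * norm x)\<^sup>2)"
    by (simp add: cinner_self power_mult_distrib flip: complex_norm_square)
  then have "(norm (c *\<^sub>C x))\<^sup>2 = (cmod c * norm x)\<^sup>2"
    by (simp only: of_real_eq_iff)
  then show ?thesis by simp
qed

text \<open>Operators live in the type of bounded real-linear maps; \<open>cbounded_ops\<close> cuts out
  the complex-linear ones. The operator \<open>c \<cdot> x\<close> is written \<open>scalar_op c o\<^sub>L x\<close>.\<close>

definition cbounded_ops :: "('h::chilbert_space \<Rightarrow>\<^sub>L 'h) set" where
  "cbounded_ops = {x. \<forall>c \<xi>. blinfun_apply x (c *\<^sub>C \<xi>) = c *\<^sub>C blinfun_apply x \<xi>}"

lift_definition scalar_op :: "complex \<Rightarrow> 'h::chilbert_space \<Rightarrow>\<^sub>L 'h" is "\<lambda>c \<xi>. c *\<^sub>C \<xi>"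
proof -
  fix c :: complex
  show "bounded_linear (\<lambda>\<xi>::'h. c *\<^sub>C \<xi>)"
  proof (rule bounded_linear_intro[where K = "cmod c"])
    fix r and x :: 'h
    show "c *\<^sub>C r *\<^sub>R x = r *\<^sub>R c *\<^sub>C x"
      by (metis scaleC_of_real scaleC_scaleC mult.commute)
  qed (simp_all add: scaleC_add_right norm_scaleC mult.commute)
qed

definition adj :: "('h::chilbert_space \<Rightarrow>\<^sub>L 'h) \<Rightarrow> 'h \<Rightarrow>\<^sub>L 'h" where
  "adj x = (THE y. \<forall>\<xi> \<eta>. cinner (blinfun_apply x \<xi>) \<eta> = cinner \<xi> (blinfun_apply y \<eta>))"

definition commutant :: "('h::chilbert_space \<Rightarrow>\<^sub>L 'h) set \<Rightarrow> ('h \<Rightarrow>\<^sub>L 'h) set" where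
  "commutant M = {y \<in> cbounded_ops. \<forall>x\<in>M. x o\<^sub>L y = y o\<^sub>L x}"

definition von_neumann_algebra :: "('h::chilbert_space \<Rightarrow>\<^sub>L 'h) set \<Rightarrow> bool" where
  "von_neumann_algebra M \<longleftrightarrow>
     M \<subseteq> cbounded_ops \<and> id_blinfun \<in> M \<and>
     (\<forall>x\<in>M. \<forall>y\<in>M. x + y \<in> M \<and> x o\<^sub>L y \<in> M) \<and>
     (\<forall>x\<in>M. (\<forall>c. scalar_op c o\<^sub>L x \<in> M) \<and> adj x \<in> M) \<and>
     commutant (commutant M) = M"

text \<open>The condition that the identity is nonzero excludes the zero algebra on the zero Hilbert
  space, whose centre is not a copy of the complex numbers.\<close>

definition vN_factor :: "('h::chilbert_space \<Rightarrow>\<^sub>L 'h) set \<Rightarrow> bool" where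
  "vN_factor M \<longleftrightarrow> von_neumann_algebra M \<and>
     (id_blinfun :: 'h \<Rightarrow>\<^sub>L 'h) \<noteq> 0 \<and> M \<inter> commutant M = range scalar_op"

definition projections :: "('h::chilbert_space \<Rightarrow>\<^sub>L 'h) set \<Rightarrow> ('h \<Rightarrow>\<^sub>L 'h) set" where
  "projections M = {p \<in> M. adj p = p \<and> p o\<^sub>L p = p}"

definition vN_sigma_finite :: "('h::chilbert_space \<Rightarrow>\<^sub>L 'h) set \<Rightarrow> bool" where
  "vN_sigma_finite M \<longleftrightarrow>
     (\<forall>P \<subseteq> projections M - {0}. pairwise (\<lambda>p q. p o\<^sub>L q = 0) P \<longrightarrow> countable P)"

definition isomorphic_to_complex :: "('h::chilbert_space \<Rightarrow>\<^sub>L 'h) set \<Rightarrow> bool" where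
  "isomorphic_to_complex M \<longleftrightarrow>
     (\<exists>\<Phi> :: ('h \<Rightarrow>\<^sub>L 'h) \<Rightarrow> complex. bij_betw \<Phi> M UNIV \<and>
        (\<forall>x\<in>M. \<forall>y\<in>M. \<Phi> (x + y) = \<Phi> x + \<Phi> y \<and> \<Phi> (x o\<^sub>L y) = \<Phi> x * \<Phi> y) \<and>
        (\<forall>x\<in>M. (\<forall>c. \<Phi> (scalar_op c o\<^sub>L x) = c * \<Phi> x) \<and> \<Phi> (adj x) = cnj (\<Phi> x)))"

definition square_summable :: "(nat \<Rightarrow> 'h::chilbert_space) \<Rightarrow> bool" where
  "square_summable \<xi> \<longleftrightarrow> summable (\<lambda>n. (norm (\<xi> n))\<^sup>2)"

text \<open>The \<open>\<sigma>\<close>-weak (ultraweak) topology: the coarsest one making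
  \<open>x \<mapsto> \<Sum>n. \<langle>\<eta> n, x (\<xi> n)\<rangle>\<close> continuous for all square-summable sequences \<open>\<xi>\<close>, \<open>\<eta>\<close>.\<close>

definition sigma_weak_topology :: "('h::chilbert_space \<Rightarrow>\<^sub>L 'h) topology" where
  "sigma_weak_topology = topology_generated_by
     {(\<lambda>x. \<Sum>n. cinner (\<eta> n) (blinfun_apply x (\<xi> n))) -` U | \<xi> \<eta> U.
        square_summable \<xi> \<and> square_summable \<eta> \<and> open U}"

text \<open>The predual: normal, i.e. \<open>\<sigma>\<close>-weakly continuous, linear functionals on \<open>M\<close>.
  Functionals are extensional, so that they are equal as soon as they agree on \<open>M\<close>.\<close>

definition predual :: "('h::chilbert_space \<Rightarrow>\<^sub>L 'h) set \<Rightarrow> (('h \<Rightarrow>\<^sub>L 'h) \<Rightarrow> complex) set" where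
  "predual M = {f \<in> extensional M.
     (\<forall>x\<in>M. \<forall>y\<in>M. f (x + y) = f x + f y) \<and>
     (\<forall>x\<in>M. \<forall>c. f (scalar_op c o\<^sub>L x) = c * f x) \<and>
     continuous_map (subtopology sigma_weak_topology M) euclidean f}"

definition functional_norm ::
    "('h::chilbert_space \<Rightarrow>\<^sub>L 'h) set \<Rightarrow> (('h \<Rightarrow>\<^sub>L 'h) \<Rightarrow> complex) \<Rightarrow> real" where
  "functional_norm M f = (SUP x\<in>{x \<in> M. norm x \<le> 1}. cmod (f x))"

text \<open>\<^locale>\<open>Metric_space\<close> asks for nonnegativity at all arguments, also outside the
  predual, where the supremum above may be unbounded.\<close>

definition predual_dist ::
    "('h::chilbert_space \<Rightarrow>\<^sub>L 'h) set \<Rightarrow> (('h \<Rightarrow>\<^sub>L 'h) \<Rightarrow> complex) \<Rightarrow>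
       (('h \<Rightarrow>\<^sub>L 'h) \<Rightarrow> complex) \<Rightarrow> real" where
  "predual_dist M f g =
     (if f \<in> predual M \<and> g \<in> predual M then functional_norm M (\<lambda>x. f x - g x) else 0)"

definition predual_norm_topology ::
    "('h::chilbert_space \<Rightarrow>\<^sub>L 'h) set \<Rightarrow> (('h \<Rightarrow>\<^sub>L 'h) \<Rightarrow> complex) topology" where
  "predual_norm_topology M = Metric_space.mtopology (predual M) (predual_dist M)"

definition normal_states ::
    "('h::chilbert_space \<Rightarrow>\<^sub>L 'h) set \<Rightarrow> (('h \<Rightarrow>\<^sub>L 'h) \<Rightarrow> complex) set" where
  "normal_states M =
     {\<phi> \<in> predual M. (\<forall>x\<in>M. \<phi> (adj x o\<^sub>L x) \<in> \<real>\<^sub>\<ge>\<^sub>0) \<and> \<phi> id_blinfun = 1}"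

definition normal_faithful_states ::
    "('h::chilbert_space \<Rightarrow>\<^sub>L 'h) set \<Rightarrow> (('h \<Rightarrow>\<^sub>L 'h) \<Rightarrow> complex) set" where
  "normal_faithful_states M =
     {\<phi> \<in> normal_states M. \<forall>x\<in>M. \<phi> (adj x o\<^sub>L x) = 0 \<longrightarrow> x = 0}"

definition unitaries :: "('h::chilbert_space \<Rightarrow>\<^sub>L 'h) set \<Rightarrow> ('h \<Rightarrow>\<^sub>L 'h) set" where
  "unitaries M = {u \<in> M. adj u o\<^sub>L u = id_blinfun \<and> u o\<^sub>L adj u = id_blinfun}"

definition conj_functional ::
    "('h::chilbert_space \<Rightarrow>\<^sub>L 'h) set \<Rightarrow> ('h \<Rightarrow>\<^sub>L 'h) \<Rightarrow> (('h \<Rightarrow>\<^sub>L 'h) \<Rightarrow> complex) \<Rightarrow>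
       ('h \<Rightarrow>\<^sub>L 'h) \<Rightarrow> complex" where
  "conj_functional M u \<phi> = (\<lambda>x\<in>M. \<phi> (adj u o\<^sub>L x o\<^sub>L u))"

definition strictly_homogeneous_state_space :: "('h::chilbert_space \<Rightarrow>\<^sub>L 'h) set \<Rightarrow> bool" where
  "strictly_homogeneous_state_space M \<longleftrightarrow>
     (\<forall>\<phi>\<in>normal_faithful_states M. \<forall>\<psi>\<in>normal_faithful_states M.
        \<exists>u\<in>unitaries M. conj_functional M u \<phi> = \<psi>)"

end

theory Submission
  imports Defs
begin

text \<open>
The idea is that strict homogeneity forces uncountably many eigenvalues on the modular operator of
one faithful state, and eigenvectors for different eigenvalues are orthogonal.

Since \<open>M\<close> is not \<open>\<complex>\<close>, it contains a projection \<open>p\<close> other than \<open>0\<close> and \<open>1\<close>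
(\<open>nontrivial_projection_exists\<close>), and \<open>\<sigma>\<close>-finiteness provides a faithful normal state
\<open>B (x) = (\<Sum>n. \<langle>\<zeta> n, x (\<zeta> n)\<rangle>)\<close> such that every \<open>\<zeta> n\<close> lies in the range of \<open>p\<close> or of
\<open>1 - p\<close> (\<open>adapted_separating_sequence\<close>); then \<open>B (x p) = B (p x)\<close>. Put \<open>s = B (p)\<close>, so
\<open>0 < s < 1\<close>. Reweighting \<open>B\<close> by \<open>\<alpha>\<close> on \<open>p\<close> and by the complementary amount on \<open>1 - p\<close> gives
another faithful normal state \<open>\<psi>\<close>, for every \<open>0 < \<alpha> < 1\<close>. By homogeneity \<open>\<psi>\<close> is the conjugate of
\<open>B\<close> under a unitary \<open>u\<close>, and comparing the two states shows that \<open>w = p u\<close> satisfies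
\<open>B (y w) = \<alpha> B (w y)\<close> for all \<open>y \<in> M\<close>, while \<open>B (w w\<^sup>*) = s\<close> (\<open>eigenoperator_exists\<close>).

For different \<open>\<alpha>\<close> these operators are orthogonal for the inner product \<open>B (v\<^sup>* w)\<close>
(\<open>eigenoperators_orthogonal\<close>), and \<open>B (w\<^sup>* w) = \<alpha> s\<close>. Hence the normal functionals
\<open>x \<mapsto> B (w\<^sup>* x)\<close>, one for each \<open>\<alpha>\<close> between \<open>1/2\<close> and \<open>1\<close>, have mutual distance at least
\<open>s / 2\<close>, as one sees by evaluating at the contraction \<open>w\<close>. A separable metric space has no
uncountable uniformly separated family.
\<close>

section \<open>Complex Hilbert spaces\<close>

lemma cinner_add_left: "cinner (x + y) z = cinner x z + cinner y (z :: 'h::chilbert_space)"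
  by (metis cinner_add_right cinner_commute complex_cnj_add)

lemma cinner_scaleC_left: "cinner (a *\<^sub>C x) y = cnj a * cinner x (y :: 'h::chilbert_space)"
  by (metis cinner_commute cinner_scaleC_right complex_cnj_mult)

lemma cinner_scaleR_right: "cinner x (r *\<^sub>R y) = of_real r * cinner x (y :: 'h::chilbert_space)"
  by (metis cinner_scaleC_right scaleC_of_real)

lemma cinner_scaleR_left: "cinner (r *\<^sub>R x) y = of_real r * cinner x (y :: 'h::chilbert_space)"
  by (metis cinner_scaleC_left scaleC_of_real complex_cnj_complex_of_real)

lemma cinner_minus_right: "cinner x (- y) = - cinner x (y :: 'h::chilbert_space)"
  using cinner_scaleR_right[of x "-1" y] by simp

lemma cinner_minus_left: "cinner (- x) y = - cinner x (y :: 'h::chilbert_space)"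
  using cinner_scaleR_left[of "-1" x y] by simp

lemma cinner_diff_right: "cinner x (y - z) = cinner x y - cinner x (z :: 'h::chilbert_space)"
  by (simp add: cinner_add_right cinner_minus_right diff_conv_add_uminus del: add_uminus_conv_diff)

lemma cinner_diff_left: "cinner (x - y) z = cinner x z - cinner y (z :: 'h::chilbert_space)"
  by (simp add: cinner_add_left cinner_minus_left diff_conv_add_uminus del: add_uminus_conv_diff)

lemma cinner_zero_right [simp]: "cinner x (0 :: 'h::chilbert_space) = 0"
  using cinner_scaleR_right[of x 0 0] by simp

lemma cinner_zero_left [simp]: "cinner (0 :: 'h::chilbert_space) x = 0"
  using cinner_scaleR_left[of 0 0 x] by simp

lemma cinner_self_eq_0 [simp]: "cinner x x = 0 \<longleftrightarrow> x = (0 :: 'h::chilbert_space)"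
  by (simp add: cinner_self)

lemma cinner_eqI:
  assumes "\<And>z. cinner x z = cinner y (z :: 'h::chilbert_space)"
  shows "x = y"
proof -
  have "cinner (x - y) (x - y) = 0"
    by (subst cinner_diff_left) (simp add: assms)
  then show ?thesis
    by simp
qed

lemma Re_cinner_commute: "Re (cinner y x) = Re (cinner x (y :: 'h::chilbert_space))"
  by (subst cinner_commute) simp

lemma norm_add_square:
  "(norm (x + y))\<^sup>2 = (norm x)\<^sup>2 + 2 * Re (cinner x y) + (norm (y :: 'h::chilbert_space))\<^sup>2"
proof -
  have "Re (cinner (x + y) (x + y)) = Re (cinner x x) + 2 * Re (cinner x y) + Re (cinner y y)"
    by (simp add: cinner_add_left cinner_add_right Re_cinner_commute[of y x])
  then show ?thesis
    by (simp add: cinner_self)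
qed

text \<open>The norm is given with its triangle inequality, so Cauchy--Schwarz is read off from it: for
  real parts by comparing both sides of the squared triangle inequality, in general after
  rotating one vector so that the inner product becomes nonnegative.\<close>

lemma cinner_Cauchy_Schwarz: "cmod (cinner x y) \<le> norm x * norm (y :: 'h::chilbert_space)"
proof (cases "cinner x y = 0")
  case False
  have Re_le: "Re (cinner v w) \<le> norm v * norm w" for v w :: 'h
  proof -
    have "(norm (v + w))\<^sup>2 \<le> (norm v + norm w)\<^sup>2"
      by (intro power_mono norm_triangle_ineq) simp
    then show ?thesis
      unfolding norm_add_square by (simp add: power2_sum)
  qed
  define c where "c = cnj (sgn (cinner x y))"
  have "c * cinner x y = of_real (cmod (cinner x y))"
    using False unfolding c_def sgn_eq
    by (simp add: divide_simps complex_norm_square power2_eq_square mult.commute flip: of_real_mult)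
       (metis complex_norm_square mult.commute of_real_mult power2_eq_square)
  then have "cmod (cinner x y) = Re (cinner x (c *\<^sub>C y))"
    by (simp add: cinner_scaleC_right)
  also have "\<dots> \<le> norm x * norm (c *\<^sub>C y)"
    by (rule Re_le)
  also have "norm (c *\<^sub>C y) = norm y"
    using False by (simp add: norm_scaleC c_def norm_sgn)
  finally show ?thesis .
qed simp

lemma bounded_bilinear_cinner:
  "bounded_bilinear (cinner :: 'h::chilbert_space \<Rightarrow> 'h \<Rightarrow> complex)"
proof
  show "\<exists>K. \<forall>a b :: 'h. cmod (cinner a b) \<le> norm a * norm b * K"
    by (rule exI[of _ 1]) (simp add: cinner_Cauchy_Schwarz)
qed (simp_all add: cinner_add_left cinner_add_right cinner_scaleR_left cinner_scaleR_right
      scaleR_conv_of_real)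

lemma scaleC_one [simp]: "1 *\<^sub>C x = (x :: 'h::chilbert_space)"
  using scaleC_of_real[of 1 x] by simp

lemma scaleC_minus_right: "c *\<^sub>C (- x) = - (c *\<^sub>C (x :: 'h::chilbert_space))"
  by (metis add.right_inverse add_cancel_right_right minus_unique scaleC_add_right)

lemma scaleC_diff_right: "c *\<^sub>C (x - y) = c *\<^sub>C x - c *\<^sub>C (y :: 'h::chilbert_space)"
  by (simp add: scaleC_add_right scaleC_minus_right diff_conv_add_uminus del: add_uminus_conv_diff)

definition closed_csubspace :: "'h::chilbert_space set \<Rightarrow> bool" where
  "closed_csubspace K \<longleftrightarrow> closed K \<and> 0 \<in> K \<and> (\<forall>x\<in>K. \<forall>y\<in>K. x + y \<in> K) \<and> (\<forall>c. \<forall>x\<in>K. c *\<^sub>C x \<in> K)"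

lemma closed_csubspace_scaleR:
  assumes "closed_csubspace K" "x \<in> K"
  shows "r *\<^sub>R x \<in> K"
  using assms scaleC_of_real[of r x] by (metis closed_csubspace_def)

lemma closed_csubspace_diff:
  assumes "closed_csubspace K" "x \<in> K" "y \<in> K"
  shows "x - y \<in> K"
  using assms closed_csubspace_scaleR[of K y "-1"]
  by (metis closed_csubspace_def diff_conv_add_uminus scaleR_minus1_left)

text \<open>A linear functional is represented on \<open>K\<close> by the minimiser of the energy
  \<open>\<parallel>x\<parallel>\<^sup>2 - 2 Re (f x)\<close>. The parallelogram law makes minimising sequences Cauchy, and the
  vanishing of the first variation is the representation formula. Working on a subspace yields
  both the Riesz theorem and orthogonal projections.\<close>

lemma riesz_on_closed_csubspace:
  fixes f :: "'h::chilbert_space \<Rightarrow> complex"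
  assumes K: "closed_csubspace K"
    and add: "\<And>x y. f (x + y) = f x + f y" and scale: "\<And>c x. f (c *\<^sub>C x) = c * f x"
    and bound: "\<And>x. cmod (f x) \<le> C * norm x"
  shows "\<exists>k\<in>K. \<forall>x\<in>K. cinner k x = f x"
proof -
  have K0: "0 \<in> K" and Kadd: "\<And>x y. x \<in> K \<Longrightarrow> y \<in> K \<Longrightarrow> x + y \<in> K"
    and KC: "\<And>c x. x \<in> K \<Longrightarrow> c *\<^sub>C x \<in> K" and Kcl: "closed K"
    using K by (auto simp: closed_csubspace_def)
  note KR = closed_csubspace_scaleR[OF K]
  have scaleR: "f (r *\<^sub>R x) = of_real r * f x" for r x
    by (metis scale scaleC_of_real)
  define J where "J = (\<lambda>x. (norm x)\<^sup>2 - 2 * Re (f x))"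
  have lower: "- C\<^sup>2 \<le> J x" for x
  proof -
    have "Re (f x) \<le> C * norm x"
      using bound[of x] complex_Re_le_cmod[of "f x"] by linarith
    moreover have "0 \<le> (norm x - C)\<^sup>2"
      by simp
    ultimately show ?thesis
      unfolding J_def by (simp add: power2_eq_square algebra_simps)
  qed
  define m where "m = Inf (J ` K)"
  have bdd: "bdd_below (J ` K)"
    using lower by (intro bdd_belowI[of _ "- C\<^sup>2"]) auto
  have m_le: "m \<le> J x" if "x \<in> K" for x
    unfolding m_def using that bdd by (intro cInf_lower) auto
  have "\<exists>x\<in>K. J x < m + inverse (real (Suc n))" for n
  proof -
    have "Inf (J ` K) < m + inverse (real (Suc n))"
      by (simp add: m_def)
    then show ?thesis
      using cInf_lessD[of "J ` K" "m + inverse (real (Suc n))"] K0 by auto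
  qed
  then obtain X where XK: "\<And>n. X n \<in> K" and XJ: "\<And>n. J (X n) < m + inverse (real (Suc n))"
    by metis
  have parallelogram: "(norm (x - y))\<^sup>2 \<le> 2 * (J x + J y - 2 * m)" if "x \<in> K" "y \<in> K" for x y
  proof -
    have "m \<le> J ((1/2) *\<^sub>R (x + y))"
      using that by (intro m_le KR Kadd)
    also have "J ((1/2) *\<^sub>R (x + y)) = (norm (x + y))\<^sup>2 / 4 - Re (f x) - Re (f y)"
      unfolding J_def scaleR add by (simp add: power_divide add_divide_distrib)
    finally have "4 * m \<le> (norm (x + y))\<^sup>2 - 4 * Re (f x) - 4 * Re (f y)"
      by simp
    moreover have "(norm (x + y))\<^sup>2 + (norm (x - y))\<^sup>2 = 2 * (norm x)\<^sup>2 + 2 * (norm y)\<^sup>2"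
      using norm_add_square[of x y] norm_add_square[of x "-y"] by (simp add: cinner_minus_right)
    ultimately show ?thesis
      unfolding J_def by simp
  qed
  have "Cauchy X"
  proof (rule CauchyI)
    fix e :: real
    assume e: "0 < e"
    then have "0 < e\<^sup>2 / 4"
      by simp
    then obtain N where N: "inverse (real (Suc N)) < e\<^sup>2 / 4"
      using reals_Archimedean by blast
    have "norm (X i - X j) < e" if "N \<le> i" "N \<le> j" for i j
    proof -
      have "inverse (real (Suc i)) \<le> inverse (real (Suc N))"
        "inverse (real (Suc j)) \<le> inverse (real (Suc N))"
        using that by (auto intro!: le_imp_inverse_le)
      then have "J (X i) + J (X j) - 2 * m < e\<^sup>2 / 2"
        using XJ[of i] XJ[of j] N by linarith
      then have "2 * (J (X i) + J (X j) - 2 * m) < e\<^sup>2"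
        by simp
      with parallelogram[OF XK[of i] XK[of j]] have "(norm (X i - X j))\<^sup>2 < e\<^sup>2"
        by (rule le_less_trans)
      then show ?thesis
        using e by (metis less_le power_less_imp_less_base)
    qed
    then show "\<exists>N. \<forall>i\<ge>N. \<forall>j\<ge>N. norm (X i - X j) < e"
      by blast
  qed
  then obtain k where lim: "X \<longlonglongrightarrow> k"
    using Cauchy_convergent convergent_def by blast
  have kK: "k \<in> K"
    using Kcl XK lim closed_sequentially by blast
  have blf: "bounded_linear f"
    by (rule bounded_linear_intro[of f C])
       (simp_all add: add scaleR bound scaleR_conv_of_real mult.commute[of _ C])
  have "(\<lambda>n. J (X n)) \<longlonglongrightarrow> J k"
    unfolding J_def by (intro tendsto_intros lim bounded_linear.tendsto[OF blf])
  moreover have "(\<lambda>n. m + inverse (real (Suc n))) \<longlonglongrightarrow> m + 0"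
    by (intro tendsto_intros LIMSEQ_inverse_real_of_nat)
  ultimately have "J k \<le> m + 0"
    using XJ by (intro LIMSEQ_le) (auto intro: less_imp_le)
  then have min: "J k \<le> J x" if "x \<in> K" for x
    using m_le[OF that] by simp
  have Re_eq: "Re (cinner k x) = Re (f x)" if x: "x \<in> K" for x
  proof (rule ccontr)
    define d where "d = Re (cinner k x) - Re (f x)"
    assume "Re (cinner k x) \<noteq> Re (f x)"
    then have d: "d \<noteq> 0"
      by (simp add: d_def)
    have var: "0 \<le> t\<^sup>2 * (norm x)\<^sup>2 + 2 * t * d" for t
    proof -
      have "J k \<le> J (k + t *\<^sub>R x)"
        using x kK by (intro min Kadd KR)
      also have "\<dots> = J k + t\<^sup>2 * (norm x)\<^sup>2 + 2 * t * d"
        unfolding J_def norm_add_square add scaleR cinner_scaleR_right d_def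
        by (simp add: power_mult_distrib algebra_simps)
      finally show ?thesis
        by simp
    qed
    \<comment> \<open>The step \<open>- d / (\<parallel>x\<parallel>\<^sup>2 + 1)\<close> makes the linear term dominate.\<close>
    define s where "s = (norm x)\<^sup>2 + 1"
    have s: "s > 0"
      unfolding s_def by (simp add: add_nonneg_pos)
    have norm_x: "(norm x)\<^sup>2 = s - 1"
      by (simp add: s_def)
    have "(- d / s)\<^sup>2 * (norm x)\<^sup>2 + 2 * (- d / s) * d = - (d\<^sup>2 / s\<^sup>2) * (s + 1)"
      unfolding norm_x using s by (simp add: field_simps power2_eq_square)
    moreover have "- (d\<^sup>2 / s\<^sup>2) * (s + 1) < 0"
      using d s by (simp add: mult_neg_pos)
    ultimately show False
      using var[of "- d / s"] by linarith
  qed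
  have "cinner k x = f x" if x: "x \<in> K" for x
  proof (rule complex_eqI)
    show "Re (cinner k x) = Re (f x)"
      by (rule Re_eq[OF x])
    show "Im (cinner k x) = Im (f x)"
      using Re_eq[OF KC[OF x], of \<i>] by (simp add: cinner_scaleC_right scale)
  qed
  then show ?thesis
    using kK by blast
qed

section \<open>Adjoints and orthogonal projections\<close>

lemma cbounded_opsD: "x \<in> cbounded_ops \<Longrightarrow> blinfun_apply x (c *\<^sub>C \<xi>) = c *\<^sub>C blinfun_apply x \<xi>"
  by (simp add: cbounded_ops_def)

lemma norm_adjoint_vector_le:
  assumes "cinner (k :: 'h::chilbert_space) k = cinner \<eta> (blinfun_apply x k)"
  shows "norm k \<le> norm \<eta> * norm x"
proof -
  have "(norm k)\<^sup>2 = cmod (cinner k k)"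
    by (simp add: cinner_self norm_power)
  also have "\<dots> = cmod (cinner \<eta> (blinfun_apply x k))"
    by (simp add: assms)
  also have "\<dots> \<le> norm \<eta> * norm (blinfun_apply x k)"
    by (rule cinner_Cauchy_Schwarz)
  also have "\<dots> \<le> norm \<eta> * (norm x * norm k)"
    by (intro mult_left_mono norm_blinfun) simp
  finally have "norm k * norm k \<le> (norm \<eta> * norm x) * norm k"
    by (simp add: power2_eq_square mult.assoc)
  then show ?thesis
    by (cases "norm k = 0") (auto simp: mult_le_cancel_right)
qed

text \<open>For \<open>K\<close> the whole space this is the adjoint of \<open>x\<close>; for \<open>x\<close> the identity it is the
  orthogonal projection onto \<open>K\<close>.\<close>

lemma compressed_adjoint_exists:
  fixes x :: "'h::chilbert_space \<Rightarrow>\<^sub>L 'h"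
  assumes x: "x \<in> cbounded_ops" and K: "closed_csubspace K"
  shows "\<exists>y\<in>cbounded_ops. \<forall>\<eta>. blinfun_apply y \<eta> \<in> K \<and>
           (\<forall>\<xi>\<in>K. cinner (blinfun_apply y \<eta>) \<xi> = cinner \<eta> (blinfun_apply x \<xi>))"
proof -
  have "\<exists>k\<in>K. \<forall>\<xi>\<in>K. cinner k \<xi> = cinner \<eta> (blinfun_apply x \<xi>)" for \<eta>
  proof (rule riesz_on_closed_csubspace[OF K])
    fix \<xi>
    have "cmod (cinner \<eta> (blinfun_apply x \<xi>)) \<le> norm \<eta> * norm (blinfun_apply x \<xi>)"
      by (rule cinner_Cauchy_Schwarz)
    also have "\<dots> \<le> norm \<eta> * (norm x * norm \<xi>)"
      by (intro mult_left_mono norm_blinfun) simp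
    finally show "cmod (cinner \<eta> (blinfun_apply x \<xi>)) \<le> (norm \<eta> * norm x) * norm \<xi>"
      by (simp add: mult.assoc)
  qed (simp_all add: blinfun.add_right cinner_add_right cbounded_opsD[OF x] cinner_scaleC_right)
  then obtain g where gK: "\<And>\<eta>. g \<eta> \<in> K"
    and g: "\<And>\<eta> \<xi>. \<xi> \<in> K \<Longrightarrow> cinner (g \<eta>) \<xi> = cinner \<eta> (blinfun_apply x \<xi>)"
    by metis
  have unique: "g \<eta> = k" if k: "k \<in> K"
    and eq: "\<And>\<xi>. \<xi> \<in> K \<Longrightarrow> cinner k \<xi> = cinner \<eta> (blinfun_apply x \<xi>)" for \<eta> k
  proof -
    have d: "g \<eta> - k \<in> K"
      using gK k by (rule closed_csubspace_diff[OF K])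
    have "cinner (g \<eta> - k) (g \<eta> - k) = 0"
      using g[OF d] eq[OF d] by (simp add: cinner_diff_left)
    then show ?thesis
      by simp
  qed
  have Kops: "\<And>x y. x \<in> K \<Longrightarrow> y \<in> K \<Longrightarrow> x + y \<in> K" "\<And>c x. x \<in> K \<Longrightarrow> c *\<^sub>C x \<in> K"
    using K by (auto simp: closed_csubspace_def)
  have gC: "g (c *\<^sub>C \<eta>) = c *\<^sub>C g \<eta>" for c \<eta>
    by (rule unique) (simp_all add: Kops gK g cinner_scaleC_left)
  have "bounded_linear g"
  proof (rule bounded_linear_intro[of g "norm x"])
    show "g (\<eta> + \<eta>') = g \<eta> + g \<eta>'" for \<eta> \<eta>'
      by (rule unique) (simp_all add: Kops gK g cinner_add_left)
    show "g (r *\<^sub>R \<eta>) = r *\<^sub>R g \<eta>" for r \<eta>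
      by (metis gC scaleC_of_real)
    show "norm (g \<eta>) \<le> norm \<eta> * norm x" for \<eta>
      by (rule norm_adjoint_vector_le) (rule g[OF gK])
  qed
  then have ap: "blinfun_apply (Blinfun g) = g"
    by (rule bounded_linear_Blinfun_apply)
  show ?thesis
    by (rule bexI[of _ "Blinfun g"]) (simp_all add: ap gK g gC cbounded_ops_def)
qed

lemma adj_unique:
  assumes "\<And>\<xi> \<eta>. cinner (blinfun_apply x \<xi>) \<eta> = cinner \<xi> (blinfun_apply y \<eta> :: 'h::chilbert_space)"
  shows "adj x = y"
  unfolding adj_def
proof (rule the_equality)
  fix z
  assume z: "\<forall>\<xi> \<eta>. cinner (blinfun_apply x \<xi>) \<eta> = cinner \<xi> (blinfun_apply z \<eta>)"
  have "blinfun_apply z \<eta> = blinfun_apply y \<eta>" for \<eta>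
    by (rule cinner_eqI) (metis assms z cinner_commute)
  then show "z = y"
    by (rule blinfun_eqI)
qed (simp add: assms)

lemma adj_exists:
  fixes x :: "'h::chilbert_space \<Rightarrow>\<^sub>L 'h"
  assumes x: "x \<in> cbounded_ops"
  shows "adj x \<in> cbounded_ops \<and> (\<forall>\<xi> \<eta>. cinner (blinfun_apply x \<xi>) \<eta> = cinner \<xi> (blinfun_apply (adj x) \<eta>))"
proof -
  have "closed_csubspace (UNIV :: 'h set)"
    by (simp add: closed_csubspace_def)
  then obtain y where y: "y \<in> cbounded_ops"
    and eq: "\<And>\<eta> \<xi>. cinner (blinfun_apply y \<eta>) \<xi> = cinner \<eta> (blinfun_apply x \<xi>)"
    using compressed_adjoint_exists[OF x] by blast
  have eq': "cinner (blinfun_apply x \<xi>) \<eta> = cinner \<xi> (blinfun_apply y \<eta>)" for \<xi> \<eta>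
    by (metis eq cinner_commute)
  then have "adj x = y"
    by (rule adj_unique)
  then show ?thesis
    using y eq' by simp
qed

lemma adj_cbounded_ops: "x \<in> cbounded_ops \<Longrightarrow> adj x \<in> cbounded_ops"
  using adj_exists by blast

lemma cinner_adj_right:
  "x \<in> cbounded_ops \<Longrightarrow> cinner \<xi> (blinfun_apply (adj x) \<eta>) = cinner (blinfun_apply x \<xi>) \<eta>"
  using adj_exists by metis

lemma cinner_adj_left:
  "x \<in> cbounded_ops \<Longrightarrow> cinner (blinfun_apply (adj x) \<xi>) \<eta> = cinner \<xi> (blinfun_apply x \<eta>)"
  by (metis cinner_adj_right cinner_commute)

lemma adj_adj: "x \<in> cbounded_ops \<Longrightarrow> adj (adj x) = x"
  by (rule adj_unique) (rule cinner_adj_left)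

lemma adj_compose:
  assumes "x \<in> cbounded_ops" "y \<in> cbounded_ops"
  shows "adj (x o\<^sub>L y) = adj y o\<^sub>L adj x"
  by (rule adj_unique) (simp add: assms cinner_adj_right)

lemma scalar_op_apply [simp]: "blinfun_apply (scalar_op c) \<xi> = c *\<^sub>C \<xi>"
  by (simp add: scalar_op.rep_eq)

lemma adj_scalar_op: "adj (scalar_op c) = scalar_op (cnj c)"
  by (rule adj_unique) (simp add: cinner_scaleC_left cinner_scaleC_right)

lemma cbounded_ops_iff_commutes: "x \<in> cbounded_ops \<longleftrightarrow> (\<forall>c. x o\<^sub>L scalar_op c = scalar_op c o\<^sub>L x)"
  by (auto simp: cbounded_ops_def intro!: blinfun_eqI) (metis blinfun_apply_blinfun_compose scalar_op_apply)

lemma id_in_commutant: "id_blinfun \<in> commutant M"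
  by (auto simp: commutant_def cbounded_ops_def intro!: blinfun_eqI)

lemma commutant_adj:
  assumes M: "M \<subseteq> cbounded_ops" "\<And>x. x \<in> M \<Longrightarrow> adj x \<in> M" and y: "y \<in> commutant M"
  shows "adj y \<in> commutant M"
proof -
  have yc: "y \<in> cbounded_ops" and comm: "\<And>x. x \<in> M \<Longrightarrow> x o\<^sub>L y = y o\<^sub>L x"
    using y by (auto simp: commutant_def)
  have "x o\<^sub>L adj y = adj y o\<^sub>L x" if x: "x \<in> M" for x
  proof -
    have "adj (adj x o\<^sub>L y) = adj (y o\<^sub>L adj x)"
      using comm[OF M(2)[OF x]] by simp
    moreover have "x \<in> cbounded_ops"
      using M x by blast
    ultimately show ?thesis
      using yc by (simp add: adj_compose adj_adj adj_cbounded_ops)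
  qed
  then show ?thesis
    by (simp add: commutant_def adj_cbounded_ops[OF yc])
qed

text \<open>Invariance of a subspace under a self-adjoint family of operators passes to its orthogonal
  complement, so the orthogonal projection commutes with the family.\<close>

lemma projection_onto_invariant_subspace:
  fixes K :: "'h::chilbert_space set"
  assumes K: "closed_csubspace K" and N: "N \<subseteq> cbounded_ops" "\<And>y. y \<in> N \<Longrightarrow> adj y \<in> N"
    and inv: "\<And>y \<xi>. y \<in> N \<Longrightarrow> \<xi> \<in> K \<Longrightarrow> blinfun_apply y \<xi> \<in> K"
  shows "\<exists>p\<in>projections (commutant N). range (blinfun_apply p) = K"
proof -
  have "id_blinfun \<in> (cbounded_ops :: ('h \<Rightarrow>\<^sub>L 'h) set)"
    by (simp add: cbounded_ops_def)
  from compressed_adjoint_exists[OF this K] obtain p where pc: "p \<in> cbounded_ops"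
    and pK: "\<And>\<eta>. blinfun_apply p \<eta> \<in> K"
    and p: "\<And>\<eta> \<xi>. \<xi> \<in> K \<Longrightarrow> cinner (blinfun_apply p \<eta>) \<xi> = cinner \<eta> \<xi>"
    by auto
  have unique: "blinfun_apply p \<eta> = k" if k: "k \<in> K"
    and eq: "\<And>\<xi>. \<xi> \<in> K \<Longrightarrow> cinner k \<xi> = cinner \<eta> \<xi>" for \<eta> k
  proof -
    have d: "blinfun_apply p \<eta> - k \<in> K"
      using pK k by (rule closed_csubspace_diff[OF K])
    have "cinner (blinfun_apply p \<eta> - k) (blinfun_apply p \<eta> - k) = 0"
      using p[OF d] eq[OF d] by (simp add: cinner_diff_left)
    then show ?thesis
      by simp
  qed
  have fixK: "blinfun_apply p \<xi> = \<xi>" if "\<xi> \<in> K" for \<xi>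
    by (rule unique[OF that]) simp
  have "cinner (blinfun_apply p \<xi>) \<eta> = cinner \<xi> (blinfun_apply p \<eta>)" for \<xi> \<eta>
    by (metis p pK cinner_commute)
  then have "adj p = p"
    by (rule adj_unique)
  moreover have "p o\<^sub>L p = p"
    by (rule blinfun_eqI) (simp add: fixK pK)
  moreover have "y o\<^sub>L p = p o\<^sub>L y" if y: "y \<in> N" for y
  proof (rule blinfun_eqI)
    fix \<eta>
    have yc: "y \<in> cbounded_ops"
      using N y by blast
    have "blinfun_apply p (blinfun_apply y \<eta>) = blinfun_apply y (blinfun_apply p \<eta>)"
    proof (rule unique)
      show "blinfun_apply y (blinfun_apply p \<eta>) \<in> K"
        by (intro inv y pK)
      fix \<xi>
      assume \<xi>: "\<xi> \<in> K"
      have "cinner (blinfun_apply y (blinfun_apply p \<eta>)) \<xi> = cinner (blinfun_apply p \<eta>) (blinfun_apply (adj y) \<xi>)"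
        by (simp add: cinner_adj_right yc)
      also have "\<dots> = cinner \<eta> (blinfun_apply (adj y) \<xi>)"
        by (intro p inv N(2) y \<xi>)
      finally show "cinner (blinfun_apply y (blinfun_apply p \<eta>)) \<xi> = cinner (blinfun_apply y \<eta>) \<xi>"
        by (simp add: cinner_adj_right yc)
    qed
    then show "blinfun_apply (y o\<^sub>L p) \<eta> = blinfun_apply (p o\<^sub>L y) \<eta>"
      by simp
  qed
  moreover have "range (blinfun_apply p) = K"
    using pK fixK by (metis (no_types, lifting) image_subset_iff rangeI subsetI subset_antisym UNIV_I)
  ultimately show ?thesis
    using pc by (auto simp: projections_def commutant_def intro!: bexI[of _ p])
qed

section \<open>Nontrivial projections\<close>

text \<open>If \<open>a = 1 - s\<close>, the equation for \<open>z\<close> says \<open>(1 - z)\<^sup>2 = s\<close>. The iteration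
  \<open>z \<mapsto> (a + z\<^sup>2) / 2\<close> from \<open>0\<close> stays in the closed algebra generated by \<open>a\<close>, and its increments are
  dominated by those of the scalar iteration with \<open>a = 1\<close>, which increases to \<open>1\<close>.\<close>

lemma contraction_square_root:
  fixes a :: "'h::banach \<Rightarrow>\<^sub>L 'h"
  assumes a: "norm a \<le> 1"
  shows "\<exists>z. norm z \<le> 1 \<and> a + (z o\<^sub>L z) = 2 *\<^sub>R z \<and> (\<forall>b. a o\<^sub>L b = b o\<^sub>L a \<longrightarrow> z o\<^sub>L b = b o\<^sub>L z)"
proof -
  define t where "t = rec_nat (0::real) (\<lambda>_ x. (1 + x\<^sup>2) / 2)"
  have t0: "t 0 = 0" and tS: "t (Suc n) = (1 + (t n)\<^sup>2) / 2" for n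
    by (simp_all add: t_def)
  define Z where "Z = rec_nat (0 :: 'h \<Rightarrow>\<^sub>L 'h) (\<lambda>_ x. (1/2) *\<^sub>R (a + (x o\<^sub>L x)))"
  have Z0: "Z 0 = 0" and ZS: "Z (Suc n) = (1/2) *\<^sub>R (a + (Z n o\<^sub>L Z n))" for n
    by (simp_all add: Z_def)
  have t_range: "0 \<le> t n \<and> t n \<le> 1" for n
    by (induction n) (auto simp: t0 tS intro: power_le_one)
  have Z_t: "norm (Z n) \<le> t n" for n
  proof (induction n)
    case (Suc n)
    have "norm (Z n o\<^sub>L Z n) \<le> norm (Z n) * norm (Z n)"
      by (rule norm_blinfun_compose)
    also have "\<dots> \<le> t n * t n"
      using Suc t_range by (intro mult_mono) auto
    finally have "norm (a + (Z n o\<^sub>L Z n)) \<le> 1 + (t n)\<^sup>2"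
      using a norm_triangle_ineq[of a "Z n o\<^sub>L Z n"] by (simp add: power2_eq_square)
    then show ?case
      by (simp add: ZS tS)
  qed (simp add: Z0 t0)
  have Zcomm: "Z n o\<^sub>L b = b o\<^sub>L Z n" if ab: "a o\<^sub>L b = b o\<^sub>L a" for n b
  proof (induction n)
    case (Suc n)
    have e: "blinfun_apply a (blinfun_apply b \<xi>) = blinfun_apply b (blinfun_apply a \<xi>)"
      "blinfun_apply (Z n) (blinfun_apply b \<xi>) = blinfun_apply b (blinfun_apply (Z n) \<xi>)" for \<xi>
      using ab Suc by (metis blinfun_apply_blinfun_compose)+
    show ?case
      by (rule blinfun_eqI)
         (simp add: ZS e blinfun.add_left blinfun.add_right blinfun.scaleR_left blinfun.scaleR_right)
  qed (auto simp: Z0 intro!: blinfun_eqI)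
  have "Z n o\<^sub>L a = a o\<^sub>L Z n" for n
    by (rule Zcomm) simp
  then have ZZ: "Z m o\<^sub>L Z n = Z n o\<^sub>L Z m" for m n
    by (intro Zcomm) simp
  have step: "norm (Z (Suc n) - Z n) \<le> t (Suc n) - t n" for n
  proof (induction n)
    case (Suc n)
    have "Z (Suc (Suc n)) - Z (Suc n) = (1/2) *\<^sub>R ((Z (Suc n) - Z n) o\<^sub>L (Z (Suc n) + Z n))"
    proof (rule blinfun_eqI)
      fix \<xi>
      have e: "blinfun_apply (Z n) (blinfun_apply (Z (Suc n)) \<xi>) = blinfun_apply (Z (Suc n)) (blinfun_apply (Z n) \<xi>)"
        using ZZ by (metis blinfun_apply_blinfun_compose)
      show "blinfun_apply (Z (Suc (Suc n)) - Z (Suc n)) \<xi>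
          = blinfun_apply ((1/2) *\<^sub>R ((Z (Suc n) - Z n) o\<^sub>L (Z (Suc n) + Z n))) \<xi>"
        unfolding ZS[of "Suc n"]
        by (subst (3) ZS)
           (simp add: blinfun.add_left blinfun.add_right blinfun.diff_left blinfun.diff_right e
              blinfun.scaleR_left algebra_simps del: ZS)
    qed
    then have "norm (Z (Suc (Suc n)) - Z (Suc n)) \<le> (norm (Z (Suc n) - Z n) * norm (Z (Suc n) + Z n)) / 2"
      using norm_blinfun_compose[of "Z (Suc n) - Z n" "Z (Suc n) + Z n"] by simp
    also have "\<dots> \<le> ((t (Suc n) - t n) * (t (Suc n) + t n)) / 2"
    proof -
      have "norm (Z (Suc n) + Z n) \<le> t (Suc n) + t n"
        using Z_t[of n] Z_t[of "Suc n"] norm_triangle_ineq[of "Z (Suc n)" "Z n"] by linarith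
      moreover have "0 \<le> t (Suc n) - t n"
        using Suc norm_ge_zero order_trans by blast
      ultimately show ?thesis
        using Suc by (intro divide_right_mono mult_mono) auto
    qed
    also have "\<dots> = t (Suc (Suc n)) - t (Suc n)"
      by (subst (3) tS, subst tS[of "Suc n"]) (simp add: power2_eq_square algebra_simps diff_divide_distrib add_divide_distrib)
    finally show ?case .
  qed (use a in \<open>simp add: Z0 ZS t0 tS\<close>)
  have inc: "t n \<le> t (Suc n)" for n
    using step[of n] norm_ge_zero[of "Z (Suc n) - Z n"] by linarith
  have "convergent t"
    using t_range inc by (intro Bseq_mono_convergent BseqI'[of _ 1]) (auto intro: lift_Suc_mono_le)
  then have "summable (\<lambda>n. t (Suc n) - t n)"
    using telescope_summable convergent_LIMSEQ_iff by blast
  then have "summable (\<lambda>n. Z (Suc n) - Z n)"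
    by (rule summable_comparison_test') (rule step)
  then have "convergent (\<lambda>n. \<Sum>i<n. Z (Suc i) - Z i)"
    by (simp add: summable_iff_convergent)
  then have "convergent Z"
    by (simp add: sum_lessThan_telescope Z0)
  then obtain z where z: "Z \<longlonglongrightarrow> z"
    by (auto simp: convergent_def)
  have "norm z \<le> 1"
    using Z_t t_range by (intro LIMSEQ_le_const2[OF tendsto_norm[OF z]]) (meson order_trans)
  moreover have "a + (z o\<^sub>L z) = 2 *\<^sub>R z"
  proof -
    have "(\<lambda>n. a + (Z n o\<^sub>L Z n)) \<longlonglongrightarrow> a + (z o\<^sub>L z)"
      by (intro tendsto_intros z bounded_bilinear.tendsto[OF bounded_bilinear_blinfun_compose])
    moreover have "(\<lambda>n. a + (Z n o\<^sub>L Z n)) = (\<lambda>n. 2 *\<^sub>R Z (Suc n))"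
      by (simp add: ZS)
    moreover have "(\<lambda>n. 2 *\<^sub>R Z (Suc n)) \<longlonglongrightarrow> 2 *\<^sub>R z"
      by (intro tendsto_intros LIMSEQ_Suc z)
    ultimately show ?thesis
      using LIMSEQ_unique by metis
  qed
  moreover have "z o\<^sub>L b = b o\<^sub>L z" if "a o\<^sub>L b = b o\<^sub>L a" for b
  proof (rule LIMSEQ_unique)
    show "(\<lambda>n. Z n o\<^sub>L b) \<longlonglongrightarrow> (z o\<^sub>L b)"
      by (intro tendsto_intros z bounded_bilinear.tendsto[OF bounded_bilinear_blinfun_compose])
    show "(\<lambda>n. Z n o\<^sub>L b) \<longlonglongrightarrow> (b o\<^sub>L z)"
      unfolding Zcomm[OF that]
      by (intro tendsto_intros z bounded_bilinear.tendsto[OF bounded_bilinear_blinfun_compose])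
  qed
  ultimately show ?thesis
    by blast
qed

text \<open>The operator \<open>r\<close> is a nonnegative square root of \<open>y\<^sup>2\<close>, that is \<open>\<bar>y\<bar>\<close>; as \<open>y\<close> has no sign,
  \<open>r - y\<close> and \<open>r + y\<close> are nonzero, while their product vanishes. The kernel of \<open>r + y\<close> is the
  spectral subspace on which \<open>y\<close> is negative or zero.\<close>

lemma indefinite_operator_spectral_subspace:
  fixes y :: "'h::chilbert_space \<Rightarrow>\<^sub>L 'h"
  assumes y: "y \<in> cbounded_ops" and sa: "adj y = y" and ny: "norm y \<le> 1"
    and pos: "Re (cinner \<xi>\<^sub>0 (blinfun_apply y \<xi>\<^sub>0)) > 0"
    and neg: "Re (cinner \<xi>\<^sub>1 (blinfun_apply y \<xi>\<^sub>1)) < 0"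
  shows "\<exists>K. closed_csubspace K \<and> K \<noteq> {0} \<and> K \<noteq> UNIV \<and>
           (\<forall>b. b o\<^sub>L y = y o\<^sub>L b \<longrightarrow> (\<forall>\<xi>\<in>K. blinfun_apply b \<xi> \<in> K))"
proof -
  define a where "a = id_blinfun - (y o\<^sub>L y)"
  have y_sym: "cinner (blinfun_apply y \<xi>) \<eta> = cinner \<xi> (blinfun_apply y \<eta>)" for \<xi> \<eta>
    using cinner_adj_left[OF y] sa by metis
  have contr: "norm (blinfun_apply y \<xi>) \<le> norm \<xi>" for \<xi>
    using norm_blinfun[of y \<xi>] mult_right_mono[OF ny norm_ge_zero[of \<xi>]] by simp
  have "norm (blinfun_apply a \<xi>) \<le> 1 * norm \<xi>" for \<xi>
  proof -
    let ?y = "blinfun_apply y"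
    have "(norm (\<xi> + - ?y (?y \<xi>)))\<^sup>2 = (norm \<xi>)\<^sup>2 - 2 * Re (cinner (?y \<xi>) (?y \<xi>)) + (norm (?y (?y \<xi>)))\<^sup>2"
      unfolding norm_add_square by (simp add: cinner_minus_right y_sym)
    also have "\<dots> = (norm \<xi>)\<^sup>2 - 2 * (norm (?y \<xi>))\<^sup>2 + (norm (?y (?y \<xi>)))\<^sup>2"
      by (simp add: cinner_self)
    also have "\<dots> \<le> (norm \<xi>)\<^sup>2"
    proof -
      have "(norm (?y (?y \<xi>)))\<^sup>2 \<le> (norm (?y \<xi>))\<^sup>2"
        by (intro power_mono contr) simp
      moreover have "0 \<le> (norm (?y \<xi>))\<^sup>2"
        by simp
      ultimately show ?thesis
        by linarith
    qed
    finally have "(norm (\<xi> + - ?y (?y \<xi>)))\<^sup>2 \<le> (norm \<xi>)\<^sup>2" .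
    then show ?thesis
      by (simp add: a_def blinfun.diff_left power2_le_iff_abs_le)
  qed
  then have "norm a \<le> 1"
    by (intro norm_blinfun_bound) auto
  then obtain z where nz: "norm z \<le> 1" and az: "a + (z o\<^sub>L z) = 2 *\<^sub>R z"
    and zcomm: "\<And>b. a o\<^sub>L b = b o\<^sub>L a \<Longrightarrow> z o\<^sub>L b = b o\<^sub>L z"
    using contraction_square_root by blast
  define r where "r = id_blinfun - z"
  have r_comm: "r o\<^sub>L b = b o\<^sub>L r" if b: "b o\<^sub>L y = y o\<^sub>L b" for b
  proof -
    have "blinfun_apply b (blinfun_apply y \<xi>) = blinfun_apply y (blinfun_apply b \<xi>)" for \<xi>
      using b by (metis blinfun_apply_blinfun_compose)
    then have "a o\<^sub>L b = b o\<^sub>L a"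
      by (intro blinfun_eqI) (simp add: a_def blinfun.diff_left blinfun.diff_right)
    then have "z o\<^sub>L b = b o\<^sub>L z"
      by (rule zcomm)
    then have "blinfun_apply z (blinfun_apply b \<xi>) = blinfun_apply b (blinfun_apply z \<xi>)" for \<xi>
      by (metis blinfun_apply_blinfun_compose)
    then show ?thesis
      by (intro blinfun_eqI) (simp add: r_def blinfun.diff_left blinfun.diff_right)
  qed
  have r_square: "blinfun_apply r (blinfun_apply r \<xi>) = blinfun_apply y (blinfun_apply y \<xi>)" for \<xi>
  proof -
    have "blinfun_apply (a + (z o\<^sub>L z)) \<xi> = blinfun_apply (2 *\<^sub>R z) \<xi>"
      by (simp add: az)
    then show ?thesis
      by (simp add: a_def r_def blinfun.add_left blinfun.diff_left blinfun.diff_right blinfun.scaleR_left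
          scaleR_2 algebra_simps)
  qed
  have r_y: "blinfun_apply r (blinfun_apply y \<xi>) = blinfun_apply y (blinfun_apply r \<xi>)" for \<xi>
    using r_comm[of y] by (metis blinfun_apply_blinfun_compose)
  have r_nonneg: "0 \<le> Re (cinner \<xi> (blinfun_apply r \<xi>))" for \<xi>
  proof -
    have "Re (cinner \<xi> (blinfun_apply z \<xi>)) \<le> norm \<xi> * norm (blinfun_apply z \<xi>)"
      using cinner_Cauchy_Schwarz complex_Re_le_cmod order_trans by blast
    also have "\<dots> \<le> norm \<xi> * (1 * norm \<xi>)"
      using norm_blinfun[of z \<xi>] mult_right_mono[OF nz norm_ge_zero[of \<xi>]] by (intro mult_left_mono) auto
    finally show ?thesis
      by (simp add: r_def blinfun.diff_left cinner_diff_right cinner_self power2_eq_square)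
  qed
  define K where "K = {\<xi>. blinfun_apply (r + y) \<xi> = 0}"
  have "closed_csubspace K"
  proof -
    have "closed K"
      unfolding K_def by (intro closed_Collect_eq continuous_intros)
    moreover have "c *\<^sub>C \<xi> \<in> K" if "\<xi> \<in> K" for c \<xi>
    proof -
      have "scalar_op c o\<^sub>L y = y o\<^sub>L scalar_op c"
        using y by (simp add: cbounded_ops_iff_commutes)
      from r_comm[OF this] have "blinfun_apply r (c *\<^sub>C \<xi>) = c *\<^sub>C blinfun_apply r \<xi>"
        by (metis blinfun_apply_blinfun_compose scalar_op_apply)
      moreover have "c *\<^sub>C (0 :: 'h) = 0"
        by (metis scaleC_diff_right diff_self)
      ultimately show ?thesis
        using that by (simp add: K_def blinfun.add_left cbounded_opsD[OF y] flip: scaleC_add_right)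
    qed
    ultimately show ?thesis
      by (auto simp: closed_csubspace_def K_def blinfun.add_right)
  qed
  moreover have "K \<noteq> {0}"
  proof
    assume K0: "K = {0}"
    have "blinfun_apply r \<xi>\<^sub>1 - blinfun_apply y \<xi>\<^sub>1 \<in> K"
      by (simp add: K_def blinfun.add_left blinfun.diff_right r_square r_y)
    then have "blinfun_apply r \<xi>\<^sub>1 = blinfun_apply y \<xi>\<^sub>1"
      using K0 by simp
    then show False
      using r_nonneg[of \<xi>\<^sub>1] neg by simp
  qed
  moreover have "K \<noteq> UNIV"
  proof
    assume "K = UNIV"
    then have "blinfun_apply r \<xi>\<^sub>0 = - blinfun_apply y \<xi>\<^sub>0"
      by (auto simp: K_def blinfun.add_left eq_neg_iff_add_eq_0)
    then show False
      using r_nonneg[of \<xi>\<^sub>0] pos by (simp add: cinner_minus_right)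
  qed
  moreover have "blinfun_apply b \<xi> \<in> K" if "b o\<^sub>L y = y o\<^sub>L b" "\<xi> \<in> K" for b \<xi>
  proof -
    have "blinfun_apply (r + y) (blinfun_apply b \<xi>) = blinfun_apply b (blinfun_apply (r + y) \<xi>)"
      using r_comm[OF that(1)] that(1)
      by (simp add: blinfun.add_left blinfun.add_right) (metis blinfun_apply_blinfun_compose)
    then show ?thesis
      using that(2) by (simp add: K_def)
  qed
  ultimately show ?thesis
    by blast
qed

lemma von_neumann_algebraD:
  assumes "von_neumann_algebra M"
  shows "M \<subseteq> cbounded_ops" "id_blinfun \<in> M" "\<And>x y. x \<in> M \<Longrightarrow> y \<in> M \<Longrightarrow> x + y \<in> M"
    "\<And>x y. x \<in> M \<Longrightarrow> y \<in> M \<Longrightarrow> x o\<^sub>L y \<in> M" "\<And>c x. x \<in> M \<Longrightarrow> scalar_op c o\<^sub>L x \<in> M"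
    "\<And>x. x \<in> M \<Longrightarrow> adj x \<in> M" "commutant (commutant M) = M" "\<And>c. scalar_op c \<in> M"
    "\<And>x r. x \<in> M \<Longrightarrow> r *\<^sub>R x \<in> M" "\<And>x y. x \<in> M \<Longrightarrow> y \<in> M \<Longrightarrow> x - y \<in> M" "0 \<in> M"
proof -
  show *: "M \<subseteq> cbounded_ops" "id_blinfun \<in> M" "\<And>x y. x \<in> M \<Longrightarrow> y \<in> M \<Longrightarrow> x + y \<in> M"
    "\<And>x y. x \<in> M \<Longrightarrow> y \<in> M \<Longrightarrow> x o\<^sub>L y \<in> M" "\<And>c x. x \<in> M \<Longrightarrow> scalar_op c o\<^sub>L x \<in> M"
    "\<And>x. x \<in> M \<Longrightarrow> adj x \<in> M" "commutant (commutant M) = M"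
    using assms by (auto simp: von_neumann_algebra_def)
  show "scalar_op c \<in> M" for c
  proof -
    have "scalar_op c o\<^sub>L id_blinfun = scalar_op c"
      by (rule blinfun_eqI) simp
    then show ?thesis
      using *(2,5) by metis
  qed
  show R: "r *\<^sub>R x \<in> M" if "x \<in> M" for r x
  proof -
    have "scalar_op (of_real r) o\<^sub>L x = r *\<^sub>R x"
      by (rule blinfun_eqI) (simp add: scaleC_of_real blinfun.scaleR_left)
    then show ?thesis
      using *(5) that by metis
  qed
  show "x - y \<in> M" if "x \<in> M" "y \<in> M" for x y
    using *(3)[OF that(1) R[OF that(2), of "-1"]] by simp
  show "0 \<in> M"
    using R[OF *(2), of 0] by simp
qed

text \<open>Polarisation at \<open>s \<eta>\<close> and \<open>\<eta>\<close> turns the vanishing quadratic form into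
  \<open>2 \<parallel>s \<eta>\<parallel>\<^sup>2 = 0\<close>.\<close>

lemma self_adjoint_eq_0I:
  fixes s :: "'h::chilbert_space \<Rightarrow>\<^sub>L 'h"
  assumes s: "s \<in> cbounded_ops" "adj s = s" and zero: "\<And>\<xi>. Re (cinner \<xi> (blinfun_apply s \<xi>)) = 0"
  shows "s = 0"
proof (rule blinfun_eqI)
  fix \<eta>
  let ?s = "blinfun_apply s"
  have sym: "cinner (?s \<xi>) \<zeta> = cinner \<xi> (?s \<zeta>)" for \<xi> \<zeta>
    using cinner_adj_left[OF s(1)] s(2) by metis
  have "Re (cinner (?s \<eta> + \<eta>) (?s (?s \<eta> + \<eta>))) = 0"
    by (rule zero)
  then have "Re (cinner (?s \<eta>) (?s \<eta>)) + Re (cinner \<eta> (?s (?s \<eta>))) = 0"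
    using zero[of \<eta>] zero[of "?s \<eta>"] by (simp add: blinfun.add_right cinner_add_left cinner_add_right)
  then show "?s \<eta> = blinfun_apply 0 \<eta>"
    by (simp add: sym[symmetric] cinner_self)
qed

text \<open>A self-adjoint operator that is not a scalar has two distinct values of its quadratic form on unit
  vectors; subtracting their mean makes it indefinite.\<close>

lemma nontrivial_projection_of_self_adjoint:
  fixes M :: "('h::chilbert_space \<Rightarrow>\<^sub>L 'h) set"
  assumes M: "von_neumann_algebra M" and y: "y \<in> M" "adj y = y" "y \<notin> range scalar_op"
    and ne: "(id_blinfun :: 'h \<Rightarrow>\<^sub>L 'h) \<noteq> 0"
  shows "\<exists>p\<in>projections M. p \<noteq> 0 \<and> p \<noteq> id_blinfun"
proof -
  note vN = von_neumann_algebraD[OF M]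
  define Q where "Q = (\<lambda>\<xi>. Re (cinner \<xi> (blinfun_apply y \<xi>)))"
  have "\<exists>\<xi>\<^sub>0 :: 'h. \<xi>\<^sub>0 \<noteq> 0"
  proof (rule ccontr)
    assume "\<nexists>\<xi>\<^sub>0 :: 'h. \<xi>\<^sub>0 \<noteq> 0"
    then have "(id_blinfun :: 'h \<Rightarrow>\<^sub>L 'h) = 0"
      by (intro blinfun_eqI) auto
    then show False
      using ne by simp
  qed
  then obtain \<xi>\<^sub>0 :: 'h where \<xi>\<^sub>0: "\<xi>\<^sub>0 \<noteq> 0"
    by blast
  have shift: "y - t *\<^sub>R id_blinfun \<in> M \<and> adj (y - t *\<^sub>R id_blinfun) = y - t *\<^sub>R id_blinfun \<and>
      Re (cinner \<xi> (blinfun_apply (y - t *\<^sub>R id_blinfun) \<xi>)) = Q \<xi> - t * (norm \<xi>)\<^sup>2" for t \<xi>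
  proof (intro conjI)
    show "y - t *\<^sub>R id_blinfun \<in> M"
      by (intro vN y)
    have "cinner (blinfun_apply y \<xi>) \<eta> = cinner \<xi> (blinfun_apply y \<eta>)" for \<xi> \<eta>
      using cinner_adj_left vN(1) y by (metis subsetD)
    then show "adj (y - t *\<^sub>R id_blinfun) = y - t *\<^sub>R id_blinfun"
      by (intro adj_unique) (simp add: blinfun.diff_left blinfun.scaleR_left cinner_diff_left
            cinner_diff_right cinner_scaleR_left cinner_scaleR_right)
    show "Re (cinner \<xi> (blinfun_apply (y - t *\<^sub>R id_blinfun) \<xi>)) = Q \<xi> - t * (norm \<xi>)\<^sup>2"
      by (simp add: Q_def blinfun.diff_left blinfun.scaleR_left cinner_diff_right cinner_scaleR_right cinner_self)
  qed
  define t\<^sub>0 where "t\<^sub>0 = Q \<xi>\<^sub>0 / (norm \<xi>\<^sub>0)\<^sup>2"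
  have "\<exists>\<xi>\<^sub>1. Q \<xi>\<^sub>1 \<noteq> t\<^sub>0 * (norm \<xi>\<^sub>1)\<^sup>2"
  proof (rule ccontr)
    assume "\<nexists>\<xi>\<^sub>1. Q \<xi>\<^sub>1 \<noteq> t\<^sub>0 * (norm \<xi>\<^sub>1)\<^sup>2"
    then have "y - t\<^sub>0 *\<^sub>R id_blinfun = 0"
      using shift[of t\<^sub>0] vN(1) by (intro self_adjoint_eq_0I) auto
    then have "y = t\<^sub>0 *\<^sub>R id_blinfun"
      by simp
    also have "\<dots> = scalar_op (of_real t\<^sub>0)"
      by (rule blinfun_eqI) (simp add: blinfun.scaleR_left scaleC_of_real)
    finally show False
      using y(3) by blast
  qed
  then obtain \<xi>\<^sub>1 where \<xi>\<^sub>1: "Q \<xi>\<^sub>1 \<noteq> t\<^sub>0 * (norm \<xi>\<^sub>1)\<^sup>2"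
    by blast
  then have "\<xi>\<^sub>1 \<noteq> 0"
    by (auto simp: Q_def)
  define t\<^sub>1 where "t\<^sub>1 = Q \<xi>\<^sub>1 / (norm \<xi>\<^sub>1)\<^sup>2"
  have Q0: "Q \<xi>\<^sub>0 = t\<^sub>0 * (norm \<xi>\<^sub>0)\<^sup>2" and Q1: "Q \<xi>\<^sub>1 = t\<^sub>1 * (norm \<xi>\<^sub>1)\<^sup>2"
    using \<xi>\<^sub>0 \<open>\<xi>\<^sub>1 \<noteq> 0\<close> by (simp_all add: t\<^sub>0_def t\<^sub>1_def)
  have t: "t\<^sub>0 \<noteq> t\<^sub>1"
    using \<xi>\<^sub>1 Q1 by auto
  define y' where "y' = y - ((t\<^sub>0 + t\<^sub>1) / 2) *\<^sub>R id_blinfun"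
  define c where "c = inverse (1 + norm y')"
  have c: "c > 0" "norm (c *\<^sub>R y') \<le> 1"
    unfolding c_def by (simp_all add: add_pos_nonneg divide_simps)
  have y': "y' \<in> M" "adj y' = y'" "\<And>\<xi>. Re (cinner \<xi> (blinfun_apply y' \<xi>)) = Q \<xi> - ((t\<^sub>0 + t\<^sub>1) / 2) * (norm \<xi>)\<^sup>2"
    unfolding y'_def using shift by blast+
  have cy': "c *\<^sub>R y' \<in> M" "adj (c *\<^sub>R y') = c *\<^sub>R y'"
  proof -
    show "c *\<^sub>R y' \<in> M"
      by (intro vN y')
    have "cinner (blinfun_apply y' \<xi>) \<eta> = cinner \<xi> (blinfun_apply y' \<eta>)" for \<xi> \<eta>
      using cinner_adj_left vN(1) y' by (metis subsetD)
    then show "adj (c *\<^sub>R y') = c *\<^sub>R y'"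
      by (intro adj_unique) (simp add: blinfun.scaleR_left cinner_scaleR_left cinner_scaleR_right)
  qed
  have Qc: "Re (cinner \<xi> (blinfun_apply (c *\<^sub>R y') \<xi>)) = c * (Q \<xi> - ((t\<^sub>0 + t\<^sub>1) / 2) * (norm \<xi>)\<^sup>2)" for \<xi>
    by (simp add: blinfun.scaleR_left cinner_scaleR_right y'(3))
  have Qc0: "Re (cinner \<xi>\<^sub>0 (blinfun_apply (c *\<^sub>R y') \<xi>\<^sub>0)) = c * (norm \<xi>\<^sub>0)\<^sup>2 * ((t\<^sub>0 - t\<^sub>1) / 2)"
    and Qc1: "Re (cinner \<xi>\<^sub>1 (blinfun_apply (c *\<^sub>R y') \<xi>\<^sub>1)) = c * (norm \<xi>\<^sub>1)\<^sup>2 * ((t\<^sub>1 - t\<^sub>0) / 2)"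
    unfolding Qc Q0 Q1 by (simp_all add: field_simps)
  have "\<exists>\<xi> \<eta>. Re (cinner \<xi> (blinfun_apply (c *\<^sub>R y') \<xi>)) > 0 \<and> Re (cinner \<eta> (blinfun_apply (c *\<^sub>R y') \<eta>)) < 0"
  proof (cases "t\<^sub>0 < t\<^sub>1")
    case True
    then have "c * (norm \<xi>\<^sub>0)\<^sup>2 * ((t\<^sub>0 - t\<^sub>1) / 2) < 0" "0 < c * (norm \<xi>\<^sub>1)\<^sup>2 * ((t\<^sub>1 - t\<^sub>0) / 2)"
      using c(1) \<xi>\<^sub>0 \<open>\<xi>\<^sub>1 \<noteq> 0\<close> by (auto simp: zero_less_mult_iff mult_less_0_iff)
    then show ?thesis
      by (intro exI[of _ "\<xi>\<^sub>1"] exI[of _ "\<xi>\<^sub>0"] conjI) (simp_all only: Qc0 Qc1)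
  next
    case False
    then have "0 < c * (norm \<xi>\<^sub>0)\<^sup>2 * ((t\<^sub>0 - t\<^sub>1) / 2)" "c * (norm \<xi>\<^sub>1)\<^sup>2 * ((t\<^sub>1 - t\<^sub>0) / 2) < 0"
      using c(1) \<xi>\<^sub>0 \<open>\<xi>\<^sub>1 \<noteq> 0\<close> t by (auto simp: zero_less_mult_iff mult_less_0_iff)
    then show ?thesis
      by (intro exI[of _ "\<xi>\<^sub>0"] exI[of _ "\<xi>\<^sub>1"] conjI) (simp_all only: Qc0 Qc1)
  qed
  then obtain \<xi> \<eta> where indef: "Re (cinner \<xi> (blinfun_apply (c *\<^sub>R y') \<xi>)) > 0"
    "Re (cinner \<eta> (blinfun_apply (c *\<^sub>R y') \<eta>)) < 0"
    by metis
  have "c *\<^sub>R y' \<in> cbounded_ops"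
    using cy'(1) vN(1) by blast
  from indefinite_operator_spectral_subspace[OF this cy'(2) c(2) indef]
  obtain K where K: "closed_csubspace K" "K \<noteq> {0}" "K \<noteq> UNIV"
    and inv: "\<And>b \<xi>. b o\<^sub>L (c *\<^sub>R y') = (c *\<^sub>R y') o\<^sub>L b \<Longrightarrow> \<xi> \<in> K \<Longrightarrow> blinfun_apply b \<xi> \<in> K"
    by metis
  have "\<exists>p\<in>projections (commutant (commutant M)). range (blinfun_apply p) = K"
  proof (rule projection_onto_invariant_subspace[OF K(1)])
    show "commutant M \<subseteq> cbounded_ops"
      by (auto simp: commutant_def)
    show "adj b \<in> commutant M" if "b \<in> commutant M" for b
      using commutant_adj[OF vN(1) vN(6) that] .
    show "blinfun_apply b \<xi> \<in> K" if "b \<in> commutant M" "\<xi> \<in> K" for b \<xi>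
      using that cy'(1) by (intro inv) (auto simp: commutant_def)
  qed
  then obtain p where "p \<in> projections M" "range (blinfun_apply p) = K"
    using vN(7) by auto
  then show ?thesis
    using K by (intro bexI[of _ p]) auto
qed

lemma scalar_algebra_isomorphic_to_complex:
  fixes M :: "('h::chilbert_space \<Rightarrow>\<^sub>L 'h) set"
  assumes M: "M = range scalar_op" and ne: "(id_blinfun :: 'h \<Rightarrow>\<^sub>L 'h) \<noteq> 0"
  shows "isomorphic_to_complex M"
proof -
  let ?S = "scalar_op :: complex \<Rightarrow> 'h \<Rightarrow>\<^sub>L 'h"
  have add: "?S a + ?S b = ?S (a + b)" for a b
    by (rule blinfun_eqI) (simp add: blinfun.add_left scaleC_add_left)
  have mult: "?S a o\<^sub>L ?S b = ?S (a * b)" for a b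
    by (rule blinfun_eqI) (simp add: scaleC_scaleC)
  have one: "?S 1 = id_blinfun"
    by (rule blinfun_eqI) simp
  have zero: "c = 0" if "?S c = 0" for c
  proof (rule ccontr)
    assume "c \<noteq> 0"
    then have "?S (inverse c) o\<^sub>L ?S c = id_blinfun"
      by (simp add: mult one)
    moreover have "?S (inverse c) o\<^sub>L ?S c = 0"
      using that by (intro blinfun_eqI) (simp add: blinfun.zero_right del: scalar_op_apply)
    ultimately show False
      using ne by simp
  qed
  have inj: "inj ?S"
  proof (rule injI)
    fix a b
    assume "?S a = ?S b"
    then have "?S (a - b) = ?S b - ?S b"
      using add[of "a - b" b] by (simp add: eq_diff_eq)
    then show "a = b"
      using zero[of "a - b"] by simp
  qed
  then have inv: "inv ?S (?S c) = c" for c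
    by simp
  show ?thesis
    unfolding isomorphic_to_complex_def
  proof (rule exI[of _ "inv ?S"], intro conjI)
    show "bij_betw (inv ?S) M UNIV"
      unfolding M by (rule bij_betw_byWitness[of _ ?S]) (auto simp: inv)
  qed (auto simp: M add mult inv adj_scalar_op)
qed

text \<open>If all projections are trivial, every self-adjoint element of \<open>M\<close> is a scalar, and the
  self-adjoint elements span \<open>M\<close>.\<close>

lemma nontrivial_projection_exists:
  fixes M :: "('h::chilbert_space \<Rightarrow>\<^sub>L 'h) set"
  assumes M: "von_neumann_algebra M" and ne: "(id_blinfun :: 'h \<Rightarrow>\<^sub>L 'h) \<noteq> 0"
    and "\<not> isomorphic_to_complex M"
  shows "\<exists>p\<in>projections M. p \<noteq> 0 \<and> p \<noteq> id_blinfun"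
proof (rule ccontr)
  note vN = von_neumann_algebraD[OF M]
  assume no: "\<not> (\<exists>p\<in>projections M. p \<noteq> 0 \<and> p \<noteq> id_blinfun)"
  have sa: "y \<in> range scalar_op" if "y \<in> M" "adj y = y" for y
    using nontrivial_projection_of_self_adjoint[OF M that _ ne] no by blast
  have "x \<in> range scalar_op" if x: "x \<in> M" for x
  proof -
    have xc: "x \<in> cbounded_ops"
      using vN(1) x by blast
    note adjs = cinner_adj_right[OF xc] cinner_adj_left[OF xc]
    define y where "y = x + adj x"
    define z where "z = scalar_op \<i> o\<^sub>L (x - adj x)"
    have "y \<in> M" "z \<in> M"
      unfolding y_def z_def by (intro vN x)+
    moreover have "adj y = y"
      unfolding y_def
      by (rule adj_unique) (simp add: blinfun.add_left cinner_add_left cinner_add_right adjs)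
    moreover have "adj z = z"
      unfolding z_def
      by (rule adj_unique) (simp add: blinfun.diff_left cinner_diff_left cinner_diff_right adjs
            cinner_scaleC_left cinner_scaleC_right algebra_simps)
    ultimately obtain b c where bc: "y = scalar_op b" "z = scalar_op c"
      using sa by blast
    \<comment> \<open>\<open>2 x = y - \<i> z\<close>\<close>
    have "x = scalar_op ((b - \<i> * c) / 2)"
    proof (rule blinfun_eqI)
      fix \<xi> :: 'h
      have "((b - \<i> * c) / 2) *\<^sub>C \<xi> = (1/2) *\<^sub>C (b *\<^sub>C \<xi> + (- \<i>) *\<^sub>C c *\<^sub>C \<xi>)"
        by (simp add: scaleC_scaleC flip: scaleC_add_left)
      also have "b *\<^sub>C \<xi> = blinfun_apply x \<xi> + blinfun_apply (adj x) \<xi>"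
        using bc(1) by (metis y_def blinfun.add_left scalar_op_apply)
      also have "c *\<^sub>C \<xi> = \<i> *\<^sub>C (blinfun_apply x \<xi> - blinfun_apply (adj x) \<xi>)"
        using bc(2) by (metis z_def blinfun.diff_left scalar_op_apply blinfun_apply_blinfun_compose)
      also have "(- \<i>) *\<^sub>C \<i> *\<^sub>C (blinfun_apply x \<xi> - blinfun_apply (adj x) \<xi>) = blinfun_apply x \<xi> - blinfun_apply (adj x) \<xi>"
        by (simp add: scaleC_scaleC)
      also have "blinfun_apply x \<xi> + blinfun_apply (adj x) \<xi> + (blinfun_apply x \<xi> - blinfun_apply (adj x) \<xi>)
          = complex_of_real 2 *\<^sub>C blinfun_apply x \<xi>"
        unfolding scaleC_of_real by (simp add: scaleR_2)
      finally show "blinfun_apply x \<xi> = blinfun_apply (scalar_op ((b - \<i> * c) / 2)) \<xi>"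
        by (simp add: scaleC_scaleC)
    qed
    then show ?thesis
      by blast
  qed
  then have "M = range scalar_op"
    using vN(8) by blast
  then show False
    using scalar_algebra_isomorphic_to_complex ne assms(3) by blast
qed

section \<open>Separating sequences of vectors\<close>

definition separating :: "('h::chilbert_space \<Rightarrow>\<^sub>L 'h) set \<Rightarrow> (nat \<Rightarrow> 'h) \<Rightarrow> bool" where
  "separating M \<zeta> \<longleftrightarrow> (\<forall>x\<in>M. (\<forall>n. blinfun_apply x (\<zeta> n) = 0) \<longrightarrow> x = 0)"

lemma closed_csubspace_closure:
  fixes S :: "'h::chilbert_space set"
  assumes "0 \<in> S" and add: "\<And>x y. x \<in> S \<Longrightarrow> y \<in> S \<Longrightarrow> x + y \<in> S"
    and scale: "\<And>c x. x \<in> S \<Longrightarrow> c *\<^sub>C x \<in> S"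
  shows "closed_csubspace (closure S)"
  unfolding closed_csubspace_def
proof (intro conjI ballI allI)
  show "0 \<in> closure S"
    using assms(1) closure_subset by blast
  have add1: "x + y \<in> closure S" if x: "x \<in> S" and y: "y \<in> closure S" for x y
  proof -
    have "(\<lambda>y. x + y) ` closure S \<subseteq> closure S"
      using add[OF x] closure_subset by (intro image_closure_subset continuous_intros) auto
    then show ?thesis
      using y by blast
  qed
  show "x + y \<in> closure S" if x: "x \<in> closure S" and y: "y \<in> closure S" for x y
  proof -
    have "(\<lambda>x. x + y) ` closure S \<subseteq> closure S"
      using add1[OF _ y] by (intro image_closure_subset continuous_intros) auto
    then show ?thesis
      using x by blast
  qed
  show "c *\<^sub>C x \<in> closure S" if x: "x \<in> closure S" for c x
  proof -
    have "blinfun_apply (scalar_op c) ` closure S \<subseteq> closure S"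
      using scale closure_subset by (intro image_closure_subset continuous_intros) auto
    then show ?thesis
      using x by auto
  qed
qed simp

lemma in_commutant_iff:
  "z \<in> commutant M \<longleftrightarrow> (\<forall>c \<xi>. blinfun_apply z (c *\<^sub>C \<xi>) = c *\<^sub>C blinfun_apply z \<xi>) \<and>
     (\<forall>m\<in>M. \<forall>\<xi>. blinfun_apply m (blinfun_apply z \<xi>) = blinfun_apply z (blinfun_apply m \<xi>))"
proof -
  have "m o\<^sub>L z = z o\<^sub>L m \<longleftrightarrow> (\<forall>\<xi>. blinfun_apply m (blinfun_apply z \<xi>) = blinfun_apply z (blinfun_apply m \<xi>))" for m
    by (metis blinfun_apply_blinfun_compose blinfun_eqI)
  then show ?thesis
    by (simp add: commutant_def cbounded_ops_def)
qed

lemma commutant_operations: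
  assumes M: "M \<subseteq> cbounded_ops" and x: "x \<in> commutant M" and y: "y \<in> commutant M"
  shows "x + y \<in> commutant M" "x o\<^sub>L y \<in> commutant M" "scalar_op c o\<^sub>L x \<in> commutant M"
proof -
  have C: "blinfun_apply m (a *\<^sub>C \<xi>) = a *\<^sub>C blinfun_apply m \<xi>" if "m \<in> M" for m a \<xi>
    using that M by (intro cbounded_opsD) blast
  have mult: "a *\<^sub>C c *\<^sub>C \<xi> = c *\<^sub>C a *\<^sub>C \<xi>" for a and \<xi> :: 'a
    by (simp add: scaleC_scaleC mult.commute)
  note xy = x[unfolded in_commutant_iff] y[unfolded in_commutant_iff]
  show "x + y \<in> commutant M"
    unfolding in_commutant_iff using xy
    by (simp add: blinfun.add_left blinfun.add_right scaleC_add_right)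
  show "x o\<^sub>L y \<in> commutant M"
    unfolding in_commutant_iff using xy by simp
  show "scalar_op c o\<^sub>L x \<in> commutant M"
    unfolding in_commutant_iff using xy(1) C by (simp add: mult)
qed

lemma zero_in_commutant: "0 \<in> commutant (M :: ('h::chilbert_space \<Rightarrow>\<^sub>L 'h) set)"
proof -
  have "c *\<^sub>C (0 :: 'h) = 0" for c
    using scaleC_diff_right[of c 0 "0 :: 'h"] by simp
  then show ?thesis
    by (auto simp: commutant_def cbounded_ops_def intro!: blinfun_eqI)
qed

text \<open>The projection onto \<open>closure (M' \<xi>)\<close>, the smallest one in \<open>M\<close> that fixes \<open>\<xi>\<close>.\<close>

lemma cyclic_projection_exists:
  fixes M :: "('h::chilbert_space \<Rightarrow>\<^sub>L 'h) set"
  assumes M: "von_neumann_algebra M"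
  shows "\<exists>p\<in>projections M. range (blinfun_apply p) = closure ((\<lambda>y. blinfun_apply y \<xi>) ` commutant M)"
proof -
  note vN = von_neumann_algebraD[OF M]
  let ?N = "commutant M" and ?S = "(\<lambda>y. blinfun_apply y \<xi>) ` commutant M"
  note N = commutant_operations[OF vN(1)]
  have cl: "closed_csubspace (closure ?S)"
  proof (rule closed_csubspace_closure)
    show "0 \<in> ?S"
      using zero_in_commutant[of M] by (auto intro!: image_eqI[of _ _ 0])
    show "a + b \<in> ?S" if ab: "a \<in> ?S" "b \<in> ?S" for a b
    proof -
      obtain x y where "x \<in> ?N" "y \<in> ?N" "a = blinfun_apply x \<xi>" "b = blinfun_apply y \<xi>"
        using ab by blast
      then show ?thesis
        using N(1)[of x y] by (intro image_eqI[of _ _ "x + y"]) (auto simp: blinfun.add_left)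
    qed
    show "c *\<^sub>C a \<in> ?S" if a: "a \<in> ?S" for c a
    proof -
      obtain x where "x \<in> ?N" "a = blinfun_apply x \<xi>"
        using a by blast
      then show ?thesis
        using N(3)[of x x c] by (intro image_eqI[of _ _ "scalar_op c o\<^sub>L x"]) auto
    qed
  qed
  have sub: "?N \<subseteq> cbounded_ops"
    by (auto simp: commutant_def)
  have inv: "blinfun_apply y a \<in> closure ?S" if y: "y \<in> ?N" and a: "a \<in> closure ?S" for y a
  proof -
    have "blinfun_apply y (blinfun_apply x \<xi>) \<in> ?S" if "x \<in> ?N" for x
      using N(2)[OF y that] by (intro image_eqI[of _ _ "y o\<^sub>L x"]) auto
    then have "blinfun_apply y ` closure ?S \<subseteq> closure ?S"
      using closure_subset[of ?S] by (intro image_closure_subset continuous_intros) auto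
    then show ?thesis
      using a by blast
  qed
  have "\<exists>p\<in>projections (commutant ?N). range (blinfun_apply p) = closure ?S"
    by (rule projection_onto_invariant_subspace[OF cl sub commutant_adj[OF vN(1) vN(6)] inv])
  then show ?thesis
    unfolding vN(7) .
qed

lemma projectionsD:
  assumes "p \<in> projections M"
  shows "p \<in> M" "adj p = p" "p o\<^sub>L p = p"
  using assms by (simp_all add: projections_def)

lemma projection_cbounded:
  assumes "von_neumann_algebra M" "p \<in> projections M"
  shows "p \<in> cbounded_ops"
  using von_neumann_algebraD(1)[OF assms(1)] projectionsD(1)[OF assms(2)] by (rule subsetD)

lemma projection_symmetric:
  assumes "von_neumann_algebra M" "p \<in> projections M"
  shows "cinner (blinfun_apply p \<xi>) \<eta> = cinner \<xi> (blinfun_apply p \<eta>)"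
  using cinner_adj_left[OF projection_cbounded[OF assms], of \<xi> \<eta>]
  unfolding projectionsD(2)[OF assms(2)] .

lemma projection_idempotent:
  assumes "p \<in> projections M"
  shows "blinfun_apply p (blinfun_apply p \<xi>) = blinfun_apply p \<xi>"
  using projectionsD(3)[OF assms] blinfun_apply_blinfun_compose[of p p \<xi>] by simp

text \<open>In a maximal family \<open>X\<close> of nonzero vectors with mutually orthogonal cyclic subspaces
  \<open>closure (M' \<xi>)\<close>, the cyclic projections are orthogonal elements of \<open>M\<close>, so \<open>X\<close> is countable.
  If \<open>x \<in> M\<close> annihilates \<open>X\<close>, then it annihilates \<open>M' X\<close>, so every \<open>adj x \<eta>\<close> is orthogonal to
  \<open>M' X\<close> and vanishes by maximality.\<close>

lemma countable_separating_set:
  fixes M :: "('h::chilbert_space \<Rightarrow>\<^sub>L 'h) set"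
  assumes M: "von_neumann_algebra M" and sf: "vN_sigma_finite M"
  shows "\<exists>X. countable X \<and> (\<forall>x\<in>M. (\<forall>\<xi>\<in>X. blinfun_apply x \<xi> = 0) \<longrightarrow> x = 0)"
proof -
  note vN = von_neumann_algebraD[OF M]
  let ?N = "commutant M"
  have Nc: "y \<in> cbounded_ops" if "y \<in> ?N" for y
    using that by (simp add: commutant_def)
  define \<A> where "\<A> = {X :: 'h set. 0 \<notin> X \<and>
    (\<forall>\<xi>\<in>X. \<forall>\<eta>\<in>X. \<xi> \<noteq> \<eta> \<longrightarrow> (\<forall>y\<in>?N. cinner (blinfun_apply y \<xi>) \<eta> = 0))}"
  have "\<exists>X\<in>\<A>. \<forall>Y\<in>\<A>. X \<subseteq> Y \<longrightarrow> Y = X"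
  proof (rule subset_Zorn')
    fix C
    assume C: "subset.chain \<A> C"
    then have CA: "C \<subseteq> \<A>"
      by (simp add: subset.chain_def)
    have "cinner (blinfun_apply y \<xi>) \<eta> = 0"
      if AB: "A \<in> C" "B \<in> C" "\<xi> \<in> A" "\<eta> \<in> B" "\<xi> \<noteq> \<eta>" "y \<in> ?N" for A B \<xi> \<eta> y
    proof -
      have "A \<subseteq> B \<or> B \<subseteq> A"
        using C AB(1,2) by (auto simp: subset.chain_def)
      then obtain D where "D \<in> C" "\<xi> \<in> D" "\<eta> \<in> D"
        using AB by blast
      then show ?thesis
        using CA AB(5,6) unfolding \<A>_def by blast
    qed
    then show "\<Union> C \<in> \<A>"
      using CA unfolding \<A>_def by blast
  qed
  then obtain X where XA: "X \<in> \<A>" and Xmax: "\<And>Y. Y \<in> \<A> \<Longrightarrow> X \<subseteq> Y \<Longrightarrow> Y = X"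
    by blast
  have X0: "0 \<notin> X" and Xorth: "\<And>\<xi> \<eta> y. \<xi> \<in> X \<Longrightarrow> \<eta> \<in> X \<Longrightarrow> \<xi> \<noteq> \<eta> \<Longrightarrow> y \<in> ?N \<Longrightarrow> cinner (blinfun_apply y \<xi>) \<eta> = 0"
    using XA unfolding \<A>_def by blast+
  define K where "K = (\<lambda>\<xi>. closure ((\<lambda>y. blinfun_apply y \<xi>) ` ?N))"
  have in_K: "\<xi> \<in> K \<xi>" for \<xi>
    unfolding K_def using id_in_commutant[of M]
    by (intro subsetD[OF closure_subset]) (auto intro!: image_eqI[of _ _ id_blinfun])
  have "\<forall>\<xi>. \<exists>p\<in>projections M. range (blinfun_apply p) = K \<xi>"
    unfolding K_def using cyclic_projection_exists[OF M] by blast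
  then obtain P where P: "\<And>\<xi>. P \<xi> \<in> projections M" and rangeP: "\<And>\<xi>. range (blinfun_apply (P \<xi>)) = K \<xi>"
    by metis
  have K_orth: "cinner a b = 0" if \<xi>\<eta>: "\<xi> \<in> X" "\<eta> \<in> X" "\<xi> \<noteq> \<eta>" and a: "a \<in> K \<xi>" and b: "b \<in> K \<eta>" for \<xi> \<eta> a b
  proof -
    note cont = bounded_bilinear.continuous_on[OF bounded_bilinear_cinner]
    have "cinner (blinfun_apply y \<xi>) (blinfun_apply z \<eta>) = 0" if y: "y \<in> ?N" and z: "z \<in> ?N" for y z
    proof -
      have "adj z o\<^sub>L y \<in> ?N"
        using commutant_adj[OF vN(1) vN(6) z] y by (intro commutant_operations vN(1))
      from Xorth[OF \<xi>\<eta> this] show ?thesis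
        by (simp add: cinner_adj_left Nc z)
    qed
    moreover have "closed {b. cinner (blinfun_apply y \<xi>) b = 0}" for y
      by (intro closed_Collect_eq cont continuous_intros)
    ultimately have "K \<eta> \<subseteq> {b. cinner (blinfun_apply y \<xi>) b = 0}" if "y \<in> ?N" for y
      unfolding K_def using that by (intro closure_minimal) auto
    then have "cinner (blinfun_apply y \<xi>) b = 0" if "y \<in> ?N" for y
      using that b by blast
    moreover have "closed {a. cinner a b = 0}"
      by (intro closed_Collect_eq cont continuous_intros)
    ultimately have "K \<xi> \<subseteq> {a. cinner a b = 0}"
      unfolding K_def by (intro closure_minimal) auto
    then show ?thesis
      using a by blast
  qed
  have P_eq: "\<xi> = \<eta>" if "\<xi> \<in> X" "\<eta> \<in> X" "P \<xi> = P \<eta>" for \<xi> \<eta>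
  proof (rule ccontr)
    assume "\<xi> \<noteq> \<eta>"
    moreover have "\<xi> \<in> K \<eta>"
      using rangeP in_K that(3) by metis
    ultimately have "cinner \<xi> \<xi> = 0"
      using K_orth[of \<xi> \<eta> \<xi> \<xi>] that in_K by blast
    then show False
      using that(1) X0 by auto
  qed
  have "P \<xi> o\<^sub>L P \<eta> = 0" if "\<xi> \<in> X" "\<eta> \<in> X" "P \<xi> \<noteq> P \<eta>" for \<xi> \<eta>
  proof (rule blinfun_eqI)
    fix v
    let ?v = "blinfun_apply (P \<xi>) (blinfun_apply (P \<eta>) v)"
    have "cinner ?v ?v = cinner ?v (blinfun_apply (P \<eta>) v)"
      using projection_symmetric[OF M P[of \<xi>]] projection_idempotent[OF P[of \<xi>]] by metis
    also have "\<dots> = 0"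
      using that rangeP by (intro K_orth[of \<xi> \<eta>]) auto
    finally show "blinfun_apply (P \<xi> o\<^sub>L P \<eta>) v = blinfun_apply 0 v"
      by simp
  qed
  then have "pairwise (\<lambda>p q. p o\<^sub>L q = 0) (P ` X)"
    by (auto simp: pairwise_def)
  moreover have "P \<xi> \<noteq> 0" if "\<xi> \<in> X" for \<xi>
  proof
    assume "P \<xi> = 0"
    then have "\<xi> \<in> {0}"
      using in_K[of \<xi>] rangeP[of \<xi>] by auto
    then show False
      using that X0 by auto
  qed
  then have "P ` X \<subseteq> projections M - {0}"
    using P by auto
  ultimately have "countable (P ` X)"
    using sf unfolding vN_sigma_finite_def by blast
  moreover have "inj_on P X"
    using P_eq by (intro inj_onI) blast
  ultimately have "countable X"
    by (rule countable_image_inj_on)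
  moreover have "x = 0" if x: "x \<in> M" and zero: "\<And>\<xi>. \<xi> \<in> X \<Longrightarrow> blinfun_apply x \<xi> = 0" for x
  proof -
    have xc: "x \<in> cbounded_ops"
      using x vN(1) by blast
    have "blinfun_apply (adj x) v = 0" for v
    proof (rule ccontr)
      let ?\<eta> = "blinfun_apply (adj x) v"
      assume nz: "?\<eta> \<noteq> 0"
      have orth: "cinner (blinfun_apply y \<xi>) ?\<eta> = 0" if \<xi>: "\<xi> \<in> X" and y: "y \<in> ?N" for \<xi> y
      proof -
        have "blinfun_apply x (blinfun_apply y \<xi>) = blinfun_apply y (blinfun_apply x \<xi>)"
          using x y[unfolded in_commutant_iff] by blast
        then show ?thesis
          using zero[OF \<xi>] by (simp add: cinner_adj_right xc blinfun.zero_right)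
      qed
      have orth': "cinner (blinfun_apply y ?\<eta>) \<xi> = 0" if \<xi>: "\<xi> \<in> X" and y: "y \<in> ?N" for \<xi> y
      proof -
        have "cinner (blinfun_apply (adj y) \<xi>) ?\<eta> = 0"
          using commutant_adj[OF vN(1) vN(6) y] by (intro orth \<xi>)
        then have "cinner \<xi> (blinfun_apply y ?\<eta>) = 0"
          by (simp add: cinner_adj_left Nc y)
        then show ?thesis
          by (subst cinner_commute) simp
      qed
      have "insert ?\<eta> X \<in> \<A>"
        using X0 Xorth nz orth orth' unfolding \<A>_def by auto
      then have "?\<eta> \<in> X"
        using Xmax by blast
      then have "cinner ?\<eta> ?\<eta> = 0"
        using orth[OF _ id_in_commutant] by simp
      then show False
        using nz by simp
    qed
    then have "adj x = 0"
      by (intro blinfun_eqI) simp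
    then have "cinner (blinfun_apply x \<xi>) \<eta> = 0" for \<xi> \<eta>
      using cinner_adj_right[OF xc, of \<xi> \<eta>] by simp
    then have "cinner (blinfun_apply x \<xi>) (blinfun_apply x \<xi>) = 0" for \<xi>
      by blast
    then show ?thesis
      by (intro blinfun_eqI) simp
  qed
  ultimately show ?thesis
    by blast
qed

lemma complementary_projection:
  assumes M: "von_neumann_algebra M" and p: "p \<in> projections M"
  shows "id_blinfun - p \<in> projections M"
proof -
  have "adj (id_blinfun - p) = id_blinfun - p"
    by (rule adj_unique)
       (simp add: blinfun.diff_left cinner_diff_left cinner_diff_right projection_symmetric[OF M p])
  moreover have "(id_blinfun - p) o\<^sub>L (id_blinfun - p) = id_blinfun - p"
    by (rule blinfun_eqI) (simp add: blinfun.diff_left blinfun.diff_right projection_idempotent[OF p])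
  moreover have "id_blinfun - p \<in> M"
    by (rule von_neumann_algebraD(10)[OF M von_neumann_algebraD(2)[OF M] projectionsD(1)[OF p]])
  ultimately show ?thesis
    unfolding projections_def by blast
qed

text \<open>Splitting each vector of a separating set along \<open>p\<close> makes \<open>p\<close> commute with the associated
  functional; the weights enforce convergence and normalisation.\<close>

lemma adapted_separating_sequence:
  fixes M :: "('h::chilbert_space \<Rightarrow>\<^sub>L 'h) set"
  assumes M: "von_neumann_algebra M" and sf: "vN_sigma_finite M" and p: "p \<in> projections M"
    and ne: "(id_blinfun :: 'h \<Rightarrow>\<^sub>L 'h) \<noteq> 0"
  shows "\<exists>\<zeta>. separating M \<zeta> \<and> square_summable \<zeta> \<and> (\<Sum>n. (norm (\<zeta> n))\<^sup>2) = 1 \<and>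
           (\<forall>n. blinfun_apply p (\<zeta> n) = \<zeta> n \<or> blinfun_apply p (\<zeta> n) = 0)"
proof -
  note vN = von_neumann_algebraD[OF M]
  obtain X where X: "countable X" and sep: "\<forall>x\<in>M. (\<forall>\<xi>\<in>X. blinfun_apply x \<xi> = 0) \<longrightarrow> x = 0"
    using countable_separating_set[OF M sf] by (elim exE conjE)
  define Y where "Y = insert 0 (blinfun_apply p ` X \<union> blinfun_apply (id_blinfun - p) ` X)"
  have "countable Y" "Y \<noteq> {}"
    unfolding Y_def using X by auto
  then obtain \<eta> :: "nat \<Rightarrow> 'h" where \<eta>: "range \<eta> = Y"
    using range_from_nat_into by metis
  have split: "blinfun_apply p (\<eta> n) = \<eta> n \<or> blinfun_apply p (\<eta> n) = 0" for n
  proof -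
    have "\<eta> n \<in> Y"
      using \<eta> by blast
    then show ?thesis
      unfolding Y_def by (auto simp: projection_idempotent[OF p] blinfun.diff_left blinfun.diff_right)
  qed
  define c where "c = (\<lambda>n. (1/2) ^ n / (1 + norm (\<eta> n)))"
  have c: "c n > 0" and c_le: "c n * norm (\<eta> n) \<le> (1/2) ^ n" for n
  proof -
    have pos: "0 < 1 + norm (\<eta> n)"
      by (simp add: add_pos_nonneg)
    then show "c n > 0"
      unfolding c_def by simp
    have "c n * norm (\<eta> n) = (1/2) ^ n * (norm (\<eta> n) / (1 + norm (\<eta> n)))"
      by (simp add: c_def)
    also have "\<dots> \<le> (1/2) ^ n * 1"
      using pos by (intro mult_left_mono) auto
    finally show "c n * norm (\<eta> n) \<le> (1/2) ^ n"
      by simp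
  qed
  have summ: "summable (\<lambda>n. (norm (c n *\<^sub>R \<eta> n))\<^sup>2)"
  proof (rule summable_comparison_test'[where N = 0])
    show "summable (\<lambda>n. (1/4 :: real) ^ n)"
      by (rule summable_geometric) simp
    fix n
    have "(norm (c n *\<^sub>R \<eta> n))\<^sup>2 \<le> ((1/2) ^ n)\<^sup>2"
      using c_le[of n] c[of n] by (intro power_mono) (auto simp: less_imp_le)
    also have "\<dots> = (1/4) ^ n"
      by (simp add: power2_eq_square flip: power_mult_distrib)
    finally show "norm ((norm (c n *\<^sub>R \<eta> n))\<^sup>2) \<le> (1/4) ^ n"
      by simp
  qed
  have sep\<eta>: "x = 0" if x: "x \<in> M" and "\<And>n. blinfun_apply x (\<eta> n) = 0" for x
  proof -
    have zero: "blinfun_apply x v = 0" if "v \<in> Y" for v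
      using that \<eta> \<open>\<And>n. blinfun_apply x (\<eta> n) = 0\<close> by blast
    show ?thesis
    proof (rule sep[rule_format, OF x])
      fix \<xi>
      assume "\<xi> \<in> X"
      then have "blinfun_apply x (blinfun_apply p \<xi>) = 0" "blinfun_apply x (blinfun_apply (id_blinfun - p) \<xi>) = 0"
        by (auto intro!: zero simp: Y_def)
      then show "blinfun_apply x \<xi> = 0"
        by (simp add: blinfun.diff_left blinfun.diff_right)
    qed
  qed
  define S where "S = (\<Sum>n. (norm (c n *\<^sub>R \<eta> n))\<^sup>2)"
  have "\<exists>n. \<eta> n \<noteq> 0"
    using sep\<eta>[OF vN(2)] ne by auto
  then obtain m where "\<eta> m \<noteq> 0"
    by blast
  then have S: "S > 0"
    unfolding S_def using c[of m] by (intro suminf_pos2[OF summ, of m]) auto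
  define \<zeta> where "\<zeta> = (\<lambda>n. (c n / sqrt S) *\<^sub>R \<eta> n)"
  have \<zeta>_sq: "(norm (\<zeta> n))\<^sup>2 = (1 / S) * (norm (c n *\<^sub>R \<eta> n))\<^sup>2" for n
    using S by (simp add: \<zeta>_def power_mult_distrib power_divide)
  have "square_summable \<zeta>"
    unfolding square_summable_def \<zeta>_sq by (intro summable_mult summ)
  moreover have "(\<Sum>n. (norm (\<zeta> n))\<^sup>2) = 1"
    unfolding \<zeta>_sq suminf_mult[OF summ] using S by (simp add: S_def)
  moreover have "separating M \<zeta>"
    unfolding separating_def
  proof (intro ballI impI)
    fix x
    assume "x \<in> M" "\<forall>n. blinfun_apply x (\<zeta> n) = 0"
    moreover have "c n / sqrt S \<noteq> 0" for n
      using c[of n] S by simp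
    ultimately show "x = 0"
      by (intro sep\<eta>) (auto simp: \<zeta>_def blinfun.scaleR_right)
  qed
  moreover have "blinfun_apply p (\<zeta> n) = \<zeta> n \<or> blinfun_apply p (\<zeta> n) = 0" for n
    using split[of n] by (auto simp: \<zeta>_def blinfun.scaleR_right)
  ultimately show ?thesis
    by blast
qed

section \<open>Normal functionals\<close>

definition vector_functional ::
    "(nat \<Rightarrow> 'h::chilbert_space) \<Rightarrow> (nat \<Rightarrow> 'h) \<Rightarrow> ('h \<Rightarrow>\<^sub>L 'h) \<Rightarrow> complex" where
  "vector_functional \<eta> \<xi> x = (\<Sum>n. cinner (\<eta> n) (blinfun_apply x (\<xi> n)))"

lemma norm_cinner_apply_le:
  "cmod (cinner \<eta> (blinfun_apply x \<xi>)) \<le> norm x * ((norm \<eta>)\<^sup>2 + (norm (\<xi> :: 'h::chilbert_space))\<^sup>2)"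
proof -
  have "cmod (cinner \<eta> (blinfun_apply x \<xi>)) \<le> norm \<eta> * norm (blinfun_apply x \<xi>)"
    by (rule cinner_Cauchy_Schwarz)
  also have "\<dots> \<le> norm \<eta> * (norm x * norm \<xi>)"
    by (intro mult_left_mono norm_blinfun) simp
  also have "\<dots> = norm x * (norm \<eta> * norm \<xi>)"
    by simp
  also have "\<dots> \<le> norm x * ((norm \<eta>)\<^sup>2 + (norm \<xi>)\<^sup>2)"
  proof (intro mult_left_mono)
    have "0 \<le> (norm \<eta> - norm \<xi>)\<^sup>2" "0 \<le> norm \<eta> * norm \<xi>"
      by simp_all
    then show "norm \<eta> * norm \<xi> \<le> (norm \<eta>)\<^sup>2 + (norm \<xi>)\<^sup>2"
      unfolding power2_diff by linarith
  qed simp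
  finally show ?thesis .
qed

lemma vector_functional_abs_summable:
  assumes "square_summable \<eta>" "square_summable \<xi>"
  shows "summable (\<lambda>n. cmod (cinner (\<eta> n) (blinfun_apply x (\<xi> n))))"
proof (rule summable_comparison_test'[where N = 0])
  show "summable (\<lambda>n. norm x * ((norm (\<eta> n))\<^sup>2 + (norm (\<xi> n))\<^sup>2))"
    using assms unfolding square_summable_def by (intro summable_mult summable_add)
  show "norm (cmod (cinner (\<eta> n) (blinfun_apply x (\<xi> n)))) \<le> norm x * ((norm (\<eta> n))\<^sup>2 + (norm (\<xi> n))\<^sup>2)" for n
    using norm_cinner_apply_le by simp
qed

lemma vector_functional_sums:
  assumes "square_summable \<eta>" "square_summable \<xi>"
  shows "(\<lambda>n. cinner (\<eta> n) (blinfun_apply x (\<xi> n))) sums vector_functional \<eta> \<xi> x"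
  unfolding vector_functional_def
  by (rule summable_sums[OF summable_norm_cancel[OF vector_functional_abs_summable[OF assms]]])

lemma vector_functional_eqI:
  assumes "square_summable \<eta>" "square_summable \<xi>"
    and "(\<lambda>n. cinner (\<eta> n) (blinfun_apply x (\<xi> n))) sums a"
  shows "vector_functional \<eta> \<xi> x = a"
  using vector_functional_sums[OF assms(1,2)] assms(3) by (rule sums_unique2)

lemma vector_functional_add:
  assumes "square_summable \<eta>" "square_summable \<xi>"
  shows "vector_functional \<eta> \<xi> (x + y) = vector_functional \<eta> \<xi> x + vector_functional \<eta> \<xi> y"
  using sums_add[OF vector_functional_sums[OF assms, of x] vector_functional_sums[OF assms, of y]]
  by (intro vector_functional_eqI assms) (simp add: blinfun.add_left cinner_add_right)

lemma vector_functional_scalar: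
  assumes "square_summable \<eta>" "square_summable \<xi>"
  shows "vector_functional \<eta> \<xi> (scalar_op c o\<^sub>L x) = c * vector_functional \<eta> \<xi> x"
  using sums_mult[OF vector_functional_sums[OF assms, of x], of c]
  by (intro vector_functional_eqI assms) (simp add: cinner_scaleC_right)

lemma vector_functional_bounded_linear:
  assumes \<eta>\<xi>: "square_summable \<eta>" "square_summable (\<xi> :: nat \<Rightarrow> 'h::chilbert_space)"
  shows "bounded_linear (vector_functional \<eta> \<xi>)"
proof (rule bounded_linear_intro[where K = "\<Sum>n. (norm (\<eta> n))\<^sup>2 + (norm (\<xi> n))\<^sup>2"])
  fix x y :: "'h \<Rightarrow>\<^sub>L 'h" and r :: real
  show "vector_functional \<eta> \<xi> (x + y) = vector_functional \<eta> \<xi> x + vector_functional \<eta> \<xi> y"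
    by (rule vector_functional_add[OF \<eta>\<xi>])
  have "scalar_op (of_real r) o\<^sub>L x = r *\<^sub>R x"
    by (rule blinfun_eqI) (simp add: scaleC_of_real blinfun.scaleR_left)
  then show "vector_functional \<eta> \<xi> (r *\<^sub>R x) = r *\<^sub>R vector_functional \<eta> \<xi> x"
    using vector_functional_scalar[OF \<eta>\<xi>, of "of_real r" x] by (simp add: scaleR_conv_of_real)
  have summ: "summable (\<lambda>n. (norm (\<eta> n))\<^sup>2 + (norm (\<xi> n))\<^sup>2)"
    using \<eta>\<xi> unfolding square_summable_def by (rule summable_add)
  have "cmod (vector_functional \<eta> \<xi> x) \<le> (\<Sum>n. cmod (cinner (\<eta> n) (blinfun_apply x (\<xi> n))))"
    unfolding vector_functional_def by (rule summable_norm[OF vector_functional_abs_summable[OF \<eta>\<xi>]])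
  also have "\<dots> \<le> (\<Sum>n. norm x * ((norm (\<eta> n))\<^sup>2 + (norm (\<xi> n))\<^sup>2))"
    by (intro suminf_le norm_cinner_apply_le vector_functional_abs_summable[OF \<eta>\<xi>] summable_mult summ)
  finally show "norm (vector_functional \<eta> \<xi> x) \<le> norm x * (\<Sum>n. (norm (\<eta> n))\<^sup>2 + (norm (\<xi> n))\<^sup>2)"
    by (simp add: suminf_mult[OF summ])
qed

lemma topspace_sigma_weak_topology [simp]: "topspace (sigma_weak_topology :: ('h::chilbert_space \<Rightarrow>\<^sub>L 'h) topology) = UNIV"
proof -
  have "square_summable (\<lambda>_. 0 :: 'h)"
    by (simp add: square_summable_def)
  then have "UNIV \<in> {(\<lambda>x :: 'h \<Rightarrow>\<^sub>L 'h. \<Sum>n. cinner (\<eta> n) (blinfun_apply x (\<xi> n))) -` U | \<xi> \<eta> U.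
      square_summable \<xi> \<and> square_summable \<eta> \<and> open U}"
    by (intro CollectI exI[of _ "\<lambda>_. 0"] exI[of _ UNIV]) simp
  then show ?thesis
    unfolding sigma_weak_topology_def topology_generated_by_topspace by blast
qed

lemma vector_functional_in_predual:
  assumes M: "von_neumann_algebra M" and \<eta>\<xi>: "square_summable \<eta>" "square_summable \<xi>"
  shows "restrict (vector_functional \<eta> \<xi>) M \<in> predual M"
proof -
  note vN = von_neumann_algebraD[OF M]
  have "continuous_map sigma_weak_topology euclidean (vector_functional \<eta> \<xi>)"
    unfolding continuous_map_def
  proof (intro conjI allI impI)
    fix U :: "complex set"
    assume "openin euclidean U"
    then have "vector_functional \<eta> \<xi> -` U \<in> {(\<lambda>x. \<Sum>n. cinner (\<eta> n) (blinfun_apply x (\<xi> n))) -` U | \<xi> \<eta> U.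
        square_summable \<xi> \<and> square_summable \<eta> \<and> open U}"
      using \<eta>\<xi> unfolding vector_functional_def[abs_def] by auto
    then have "openin sigma_weak_topology (vector_functional \<eta> \<xi> -` U)"
      unfolding sigma_weak_topology_def by (rule topology_generated_by_Basis)
    then show "openin sigma_weak_topology {x \<in> topspace sigma_weak_topology. vector_functional \<eta> \<xi> x \<in> U}"
      by (simp add: vimage_def)
  qed simp
  then have "continuous_map (subtopology sigma_weak_topology M) euclidean (vector_functional \<eta> \<xi>)"
    by (rule continuous_map_from_subtopology)
  then have "continuous_map (subtopology sigma_weak_topology M) euclidean (restrict (vector_functional \<eta> \<xi>) M)"
    by (rule continuous_map_eq) simp
  then show ?thesis
    unfolding predual_def
    using vN(3,5) vector_functional_add[OF \<eta>\<xi>] vector_functional_scalar[OF \<eta>\<xi>] by simp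
qed

lemma continuous_map_norm_sigma_weak:
  "continuous_map euclidean (sigma_weak_topology :: ('h::chilbert_space \<Rightarrow>\<^sub>L 'h) topology) (\<lambda>x. x)"
  unfolding sigma_weak_topology_def
proof (rule continuous_on_generated_topo)
  fix W :: "('h \<Rightarrow>\<^sub>L 'h) set"
  assume "W \<in> {(\<lambda>x. \<Sum>n. cinner (\<eta> n) (blinfun_apply x (\<xi> n))) -` U | \<xi> \<eta> U.
      square_summable \<xi> \<and> square_summable \<eta> \<and> open U}"
  then obtain \<xi> \<eta> U where W: "W = vector_functional \<eta> \<xi> -` U" and "square_summable \<xi>" "square_summable \<eta>" "open U"
    unfolding vector_functional_def[abs_def] by blast
  then have "open (vector_functional \<eta> \<xi> -` U)"
    using linear_continuous_on[OF vector_functional_bounded_linear, of \<eta> \<xi> UNIV]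
    by (intro open_vimage)
  then show "openin euclidean ((\<lambda>x. x) -` W \<inter> topspace euclidean)"
    by (simp add: W)
next
  have "UNIV \<subseteq> topspace (sigma_weak_topology :: ('h \<Rightarrow>\<^sub>L 'h) topology)"
    by simp
  then show "(\<lambda>x. x) ` topspace euclidean \<subseteq> \<Union> {(\<lambda>x :: 'h \<Rightarrow>\<^sub>L 'h. \<Sum>n. cinner (\<eta> n) (blinfun_apply x (\<xi> n))) -` U | \<xi> \<eta> U.
      square_summable \<xi> \<and> square_summable \<eta> \<and> open U}"
    unfolding sigma_weak_topology_def topology_generated_by_topspace by simp
qed

text \<open>The norm topology is finer than the \<open>\<sigma>\<close>-weak one, so normal functionals are norm continuous,
  hence bounded. This makes the suprema that define the distance of functionals finite.\<close>

lemma predual_bounded: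
  fixes M :: "('h::chilbert_space \<Rightarrow>\<^sub>L 'h) set"
  assumes M: "von_neumann_algebra M" and f: "f \<in> predual M"
  shows "\<exists>C. \<forall>x\<in>M. norm x \<le> 1 \<longrightarrow> cmod (f x) \<le> C"
proof -
  note vN = von_neumann_algebraD[OF M]
  have fC: "\<And>x c. x \<in> M \<Longrightarrow> f (scalar_op c o\<^sub>L x) = c * f x"
    and cont: "continuous_map (subtopology sigma_weak_topology M) euclidean f"
    using f unfolding predual_def by blast+
  have scale: "f (r *\<^sub>R x) = of_real r * f x" if "x \<in> M" for r x
  proof -
    have "scalar_op (of_real r) o\<^sub>L x = r *\<^sub>R x"
      by (rule blinfun_eqI) (simp add: scaleC_of_real blinfun.scaleR_left)
    then show ?thesis
      using fC[OF that, of "of_real r"] by simp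
  qed
  have "continuous_map (top_of_set M) (subtopology sigma_weak_topology M) (\<lambda>x. x)"
    using continuous_map_from_subtopology[OF continuous_map_norm_sigma_weak, of M]
    by (intro continuous_map_into_subtopology) auto
  from continuous_map_compose[OF this cont] have "continuous_on M f"
    by (simp add: o_def)
  moreover have "f 0 = 0"
    using scale[OF vN(11), of 0] by simp
  ultimately obtain d where d: "d > 0" and small: "\<And>x. x \<in> M \<Longrightarrow> norm x < d \<Longrightarrow> cmod (f x) < 1"
    using vN(11) unfolding continuous_on_iff by (metis dist_0_norm dist_commute zero_less_one)
  have "cmod (f x) \<le> 2 / d" if x: "x \<in> M" and n: "norm x \<le> 1" for x
  proof -
    have "norm ((d / 2) *\<^sub>R x) \<le> (d / 2) * 1"
      using d n unfolding norm_scaleR by (intro mult_mono) auto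
    then have "cmod (f ((d / 2) *\<^sub>R x)) < 1"
      using d by (intro small vN(9) x) simp
    then show ?thesis
      using d by (simp add: scale[OF x] norm_mult field_simps del: norm_scaleR)
  qed
  then show ?thesis
    by blast
qed

lemma predual_dist_bdd_above:
  assumes M: "von_neumann_algebra M" and "f \<in> predual M" "g \<in> predual M"
  shows "bdd_above ((\<lambda>x. cmod (f x - g x)) ` {x \<in> M. norm x \<le> 1})"
proof -
  obtain C D where "\<forall>x\<in>M. norm x \<le> 1 \<longrightarrow> cmod (f x) \<le> C" "\<forall>x\<in>M. norm x \<le> 1 \<longrightarrow> cmod (g x) \<le> D"
    using predual_bounded[OF M] assms(2,3) by metis
  then have "cmod (f x - g x) \<le> C + D" if "x \<in> M" "norm x \<le> 1" for x
    using that norm_triangle_ineq4[of "f x" "g x"] by (smt (verit))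
  then show ?thesis
    by (intro bdd_aboveI[of _ "C + D"]) auto
qed

lemma predual_dist_ge:
  assumes "von_neumann_algebra M" "f \<in> predual M" "g \<in> predual M" "x \<in> M" "norm x \<le> 1"
  shows "cmod (f x - g x) \<le> predual_dist M f g"
  unfolding predual_dist_def functional_norm_def
  using assms predual_dist_bdd_above[OF assms(1-3)] by (auto intro!: cSUP_upper)

lemma predual_dist_le:
  assumes "von_neumann_algebra M" "f \<in> predual M" "g \<in> predual M"
    and "\<And>x. x \<in> M \<Longrightarrow> norm x \<le> 1 \<Longrightarrow> cmod (f x - g x) \<le> C"
  shows "predual_dist M f g \<le> C"
proof -
  have "0 \<in> {x \<in> M. norm x \<le> 1}"
    using von_neumann_algebraD(11)[OF assms(1)] by simp
  then show ?thesis
    unfolding predual_dist_def functional_norm_def using assms by (auto intro!: cSUP_least)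
qed

lemma Metric_space_predual:
  fixes M :: "('h::chilbert_space \<Rightarrow>\<^sub>L 'h) set"
  assumes M: "von_neumann_algebra M"
  shows "Metric_space (predual M) (predual_dist M)"
proof
  note vN = von_neumann_algebraD[OF M]
  show "0 \<le> predual_dist M f g" for f g
  proof (cases "f \<in> predual M \<and> g \<in> predual M")
    case True
    then have "cmod (f 0 - g 0) \<le> predual_dist M f g"
      by (intro predual_dist_ge M vN(11)) auto
    then show ?thesis
      using norm_ge_zero order_trans by blast
  qed (auto simp: predual_dist_def)
  show "predual_dist M f g = predual_dist M g f" for f g
    by (simp add: predual_dist_def functional_norm_def norm_minus_commute conj_commute)
  show "predual_dist M f g = 0 \<longleftrightarrow> f = g" if fg: "f \<in> predual M" "g \<in> predual M" for f g
  proof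
    assume "f = g"
    then have "functional_norm M (\<lambda>x. f x - g x) = (SUP x\<in>{x \<in> M. norm x \<le> 1}. 0)"
      by (simp add: functional_norm_def)
    also have "\<dots> = 0"
      using vN(11) by (intro cSUP_const) auto
    finally show "predual_dist M f g = 0"
      by (simp add: predual_dist_def)
  next
    assume zero: "predual_dist M f g = 0"
    have "f x = g x" if x: "x \<in> M" for x
    proof -
      define r where "r = 1 / (1 + norm x)"
      have pos: "0 < 1 + norm x"
        by (simp add: add_pos_nonneg)
      have r: "r > 0" "norm (r *\<^sub>R x) \<le> 1"
        using pos by (simp_all add: r_def)
      have eq: "r *\<^sub>R x = scalar_op (of_real r) o\<^sub>L x"
        by (rule blinfun_eqI) (simp add: scaleC_of_real blinfun.scaleR_left)
      have "cmod (f (r *\<^sub>R x) - g (r *\<^sub>R x)) \<le> 0"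
        using predual_dist_ge[OF M fg vN(9)[OF x] r(2)] zero by simp
      then have "f (r *\<^sub>R x) = g (r *\<^sub>R x)"
        by simp
      moreover have "f (r *\<^sub>R x) = of_real r * f x" "g (r *\<^sub>R x) = of_real r * g x"
        unfolding eq using fg x by (auto simp: predual_def)
      ultimately show ?thesis
        using r(1) by simp
    qed
    moreover have "f \<in> extensional M" "g \<in> extensional M"
      using fg by (auto simp: predual_def)
    ultimately show "f = g"
      by (intro extensionalityI)
  qed
  show "predual_dist M f h \<le> predual_dist M f g + predual_dist M g h"
    if fgh: "f \<in> predual M" "g \<in> predual M" "h \<in> predual M" for f g h
  proof (rule predual_dist_le[OF M fgh(1,3)])
    fix x
    assume x: "x \<in> M" "norm x \<le> 1"
    have "cmod (f x - h x) \<le> cmod (f x - g x) + cmod (g x - h x)"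
      using norm_triangle_ineq[of "f x - g x" "g x - h x"] by simp
    also have "\<dots> \<le> predual_dist M f g + predual_dist M g h"
      by (intro add_mono predual_dist_ge M fgh x)
    finally show "cmod (f x - h x) \<le> predual_dist M f g + predual_dist M g h" .
  qed
qed

lemma (in Metric_space) countable_if_uniformly_separated:
  assumes sep: "separable_space mtopology" and f: "\<And>i. i \<in> I \<Longrightarrow> f i \<in> M" and e: "e > 0"
    and dist: "\<And>i j. i \<in> I \<Longrightarrow> j \<in> I \<Longrightarrow> i \<noteq> j \<Longrightarrow> e \<le> d (f i) (f j)"
  shows "countable I"
proof -
  obtain C where C: "countable C" "C \<subseteq> M" "mtopology closure_of C = M"
    using sep unfolding separable_space_def by auto
  have "\<exists>c\<in>C. d (f i) c < e / 2" if i: "i \<in> I" for i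
  proof -
    have "f i \<in> mtopology closure_of C"
      using f[OF i] C by simp
    then have "\<exists>c\<in>C. c \<in> mball (f i) (e / 2)"
      using half_gt_zero[OF e] unfolding metric_closure_of by blast
    then show ?thesis
      by auto
  qed
  then obtain c where c: "\<And>i. i \<in> I \<Longrightarrow> c i \<in> C" "\<And>i. i \<in> I \<Longrightarrow> d (f i) (c i) < e / 2"
    by metis
  have "inj_on c I"
  proof (rule inj_onI, rule ccontr)
    fix i j
    assume ij: "i \<in> I" "j \<in> I" "c i = c j" "i \<noteq> j"
    have "d (f i) (f j) \<le> d (f i) (c i) + d (c j) (f j)"
      using triangle[of "f i" "c i" "f j"] f c C(2) ij by auto
    also have "\<dots> < e"
      using c(2)[OF ij(1)] c(2)[OF ij(2)] commute[of "c j" "f j"] by simp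
    finally show False
      using dist[OF ij(1,2,4)] by simp
  qed
  moreover have "countable (c ` I)"
    using C(1) c(1) countable_subset[of "c ` I" C] by blast
  ultimately show ?thesis
    by (rule countable_image_inj_on[rotated])
qed

section \<open>Eigenoperators of a faithful state\<close>

lemma vector_functional_adj_compose:
  assumes x: "x \<in> cbounded_ops" and \<zeta>: "square_summable \<zeta>"
  shows "summable (\<lambda>n. (norm (blinfun_apply x (\<zeta> n)))\<^sup>2)"
    and "vector_functional \<zeta> \<zeta> (adj x o\<^sub>L x) = of_real (\<Sum>n. (norm (blinfun_apply x (\<zeta> n)))\<^sup>2)"
proof -
  show summ: "summable (\<lambda>n. (norm (blinfun_apply x (\<zeta> n)))\<^sup>2)"
  proof (rule summable_comparison_test'[where N = 0])
    show "summable (\<lambda>n. (norm x)\<^sup>2 * (norm (\<zeta> n))\<^sup>2)"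
      using \<zeta> unfolding square_summable_def by (rule summable_mult)
    show "norm ((norm (blinfun_apply x (\<zeta> n)))\<^sup>2) \<le> (norm x)\<^sup>2 * (norm (\<zeta> n))\<^sup>2" for n
      using power_mono[OF norm_blinfun[of x "\<zeta> n"], of 2] by (simp add: power_mult_distrib)
  qed
  have "cinner (\<zeta> n) (blinfun_apply (adj x o\<^sub>L x) (\<zeta> n)) = of_real ((norm (blinfun_apply x (\<zeta> n)))\<^sup>2)" for n
    by (simp add: cinner_adj_right[OF x] cinner_self)
  then have "(\<lambda>n. cinner (\<zeta> n) (blinfun_apply (adj x o\<^sub>L x) (\<zeta> n)))
      sums of_real (\<Sum>n. (norm (blinfun_apply x (\<zeta> n)))\<^sup>2)"
    using sums_of_real[OF summable_sums[OF summ], where 'a = complex] by simp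
  then show "vector_functional \<zeta> \<zeta> (adj x o\<^sub>L x) = of_real (\<Sum>n. (norm (blinfun_apply x (\<zeta> n)))\<^sup>2)"
    by (rule vector_functional_eqI[OF \<zeta> \<zeta>])
qed

lemma separating_sum_pos:
  assumes M: "von_neumann_algebra M" and x: "x \<in> M" "x \<noteq> 0" and \<zeta>: "square_summable \<zeta>" "separating M \<zeta>"
  shows "0 < (\<Sum>n. (norm (blinfun_apply x (\<zeta> n)))\<^sup>2)"
proof -
  have "x \<in> cbounded_ops"
    using von_neumann_algebraD(1)[OF M] x(1) by blast
  note summ = vector_functional_adj_compose(1)[OF this \<zeta>(1)]
  obtain n where "blinfun_apply x (\<zeta> n) \<noteq> 0"
    using \<zeta>(2) x unfolding separating_def by blast
  then show ?thesis
    by (intro suminf_pos2[OF summ, of n]) auto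
qed

lemma vector_functional_adj:
  assumes x: "x \<in> cbounded_ops" and \<zeta>: "square_summable \<zeta>"
  shows "vector_functional \<zeta> \<zeta> (adj x) = cnj (vector_functional \<zeta> \<zeta> x)"
proof (rule vector_functional_eqI[OF \<zeta> \<zeta>])
  have "cinner (\<zeta> n) (blinfun_apply (adj x) (\<zeta> n)) = cnj (cinner (\<zeta> n) (blinfun_apply x (\<zeta> n)))" for n
    unfolding cinner_adj_right[OF x] by (rule cinner_commute)
  then show "(\<lambda>n. cinner (\<zeta> n) (blinfun_apply (adj x) (\<zeta> n))) sums cnj (vector_functional \<zeta> \<zeta> x)"
    using vector_functional_sums[OF \<zeta> \<zeta>, of x] by (simp add: sums_cnj)
qed

lemma vector_state_normal_faithful:
  assumes M: "von_neumann_algebra M" and \<zeta>: "square_summable \<zeta>" "separating M \<zeta>"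
    and one: "vector_functional \<zeta> \<zeta> id_blinfun = 1"
  shows "restrict (vector_functional \<zeta> \<zeta>) M \<in> normal_faithful_states M"
proof -
  note vN = von_neumann_algebraD[OF M]
  have eq: "restrict (vector_functional \<zeta> \<zeta>) M (adj x o\<^sub>L x) = of_real (\<Sum>n. (norm (blinfun_apply x (\<zeta> n)))\<^sup>2)"
    if x: "x \<in> M" for x
  proof -
    have "x \<in> cbounded_ops"
      using vN(1) x by blast
    then show ?thesis
      using vector_functional_adj_compose(2)[OF _ \<zeta>(1), of x] vN(4)[OF vN(6)[OF x] x] by simp
  qed
  have "restrict (vector_functional \<zeta> \<zeta>) M \<in> predual M"
    by (rule vector_functional_in_predual[OF M \<zeta>(1,1)])
  moreover have "restrict (vector_functional \<zeta> \<zeta>) M id_blinfun = 1"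
    using vN(2) one by simp
  moreover have "restrict (vector_functional \<zeta> \<zeta>) M (adj x o\<^sub>L x) \<in> \<real>\<^sub>\<ge>\<^sub>0" if x: "x \<in> M" for x
  proof -
    have "x \<in> cbounded_ops"
      using vN(1) x by blast
    note summ = vector_functional_adj_compose(1)[OF this \<zeta>(1)]
    show ?thesis
      unfolding eq[OF x] by (simp add: suminf_nonneg summ)
  qed
  moreover have "x = 0" if x: "x \<in> M" and zero: "restrict (vector_functional \<zeta> \<zeta>) M (adj x o\<^sub>L x) = 0" for x
  proof (rule ccontr)
    assume "x \<noteq> 0"
    from separating_sum_pos[OF M x this \<zeta>] zero show False
      unfolding eq[OF x] by simp
  qed
  ultimately show ?thesis
    unfolding normal_faithful_states_def normal_states_def by blast
qed

lemma norm_projection_le_one: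
  assumes "von_neumann_algebra M" "p \<in> projections M"
  shows "norm p \<le> 1"
proof (rule norm_blinfun_bound)
  fix \<xi>
  have "cinner (blinfun_apply p \<xi>) (blinfun_apply p \<xi>) = cinner \<xi> (blinfun_apply id_blinfun (blinfun_apply p \<xi>))"
    by (simp add: projection_symmetric[OF assms] projection_idempotent[OF assms(2)])
  then have "norm (blinfun_apply p \<xi>) \<le> norm \<xi> * norm (id_blinfun :: 'a \<Rightarrow>\<^sub>L 'a)"
    by (rule norm_adjoint_vector_le)
  also have "\<dots> \<le> norm \<xi> * 1"
    by (intro mult_left_mono norm_blinfun_id_le) simp
  finally show "norm (blinfun_apply p \<xi>) \<le> 1 * norm \<xi>"
    by simp
qed simp

lemma norm_isometry_le_one:
  assumes u: "u \<in> cbounded_ops" "adj u o\<^sub>L u = id_blinfun"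
  shows "norm u \<le> 1"
proof (rule norm_blinfun_bound)
  fix \<xi>
  have "cinner (blinfun_apply u \<xi>) (blinfun_apply u \<xi>) = cinner \<xi> (blinfun_apply (adj u o\<^sub>L u) \<xi>)"
    by (simp add: cinner_adj_right[OF u(1)])
  also have "\<dots> = cinner \<xi> \<xi>"
    unfolding u(2) by simp
  finally have "(norm (blinfun_apply u \<xi>))\<^sup>2 = (norm \<xi>)\<^sup>2"
    unfolding cinner_self of_real_eq_iff .
  then show "norm (blinfun_apply u \<xi>) \<le> 1 * norm \<xi>"
    by simp
qed simp

text \<open>Write \<open>B\<close> for the state of \<open>\<zeta>\<close>, which commutes with \<open>p\<close>. Rescaling \<open>\<zeta>\<close> on the ranges of
  \<open>p\<close> and \<open>1 - p\<close> gives a state \<open>\<psi>\<close> with \<open>\<psi> (x p) = \<alpha> B (x p)\<close>. A unitary \<open>u\<close> with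
  \<open>\<psi> = u B u\<^sup>*\<close> yields, for \<open>w = p u\<close>,
  \<open>B (y w) = B (u\<^sup>* (u y p) u) = \<psi> (u y p) = \<alpha> B (u y p) = \<alpha> B (p u y) = \<alpha> B (w y)\<close>:
  thus \<open>w\<close> lies in the eigenspace of the modular operator of \<open>B\<close> for the eigenvalue
  \<open>1 / \<alpha>\<close>.\<close>

lemma eigenoperator_exists:
  fixes M :: "('h::chilbert_space \<Rightarrow>\<^sub>L 'h) set"
  assumes M: "von_neumann_algebra M" and hom: "strictly_homogeneous_state_space M"
    and p: "p \<in> projections M"
    and \<zeta>: "square_summable \<zeta>" "separating M \<zeta>"
    and split: "\<And>n. blinfun_apply p (\<zeta> n) = \<zeta> n \<or> blinfun_apply p (\<zeta> n) = 0"
    and one: "vector_functional \<zeta> \<zeta> id_blinfun = 1"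
    and s: "vector_functional \<zeta> \<zeta> p = of_real s" "s < 1"
    and \<alpha>: "0 < \<alpha>" "\<alpha> * s < 1"
  shows "\<exists>w\<in>M. norm w \<le> 1 \<and> vector_functional \<zeta> \<zeta> (w o\<^sub>L adj w) = of_real s \<and>
           (\<forall>y\<in>M. vector_functional \<zeta> \<zeta> (y o\<^sub>L w) = of_real \<alpha> * vector_functional \<zeta> \<zeta> (w o\<^sub>L y))"
proof -
  note vN = von_neumann_algebraD[OF M]
  note p_sym = projection_symmetric[OF M p]
  define B where "B = vector_functional \<zeta> \<zeta>"
  note B_sums = vector_functional_sums[OF \<zeta>(1,1), folded B_def]
  \<comment> \<open>The weight on the range of \<open>1 - p\<close> is forced by normalisation.\<close>
  define \<beta> where "\<beta> = (1 - \<alpha> * s) / (1 - s)"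
  have \<beta>: "0 < \<beta>" "\<alpha> * s + \<beta> * (1 - s) = 1"
    using s(2) \<alpha> by (simp_all add: \<beta>_def)
  define c where "c = (\<lambda>n. sqrt (if blinfun_apply p (\<zeta> n) = \<zeta> n then \<alpha> else \<beta>))"
  define \<zeta>' where "\<zeta>' = (\<lambda>n. c n *\<^sub>R \<zeta> n)"
  have c_pos: "0 < c n" for n
    using \<alpha> \<beta> by (simp add: c_def)
  have c_sq: "of_real (c n) * (of_real (c n) * z) = of_real (if blinfun_apply p (\<zeta> n) = \<zeta> n then \<alpha> else \<beta>) * z"
    for n and z :: complex
  proof -
    have "c n * c n = (if blinfun_apply p (\<zeta> n) = \<zeta> n then \<alpha> else \<beta>)"
      using \<alpha>(1) \<beta>(1) by (simp add: c_def)
    then show ?thesis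
      by (simp only: mult.assoc[symmetric] of_real_mult[symmetric])
  qed
  have \<zeta>'_inner: "cinner (\<zeta>' n) (blinfun_apply x (\<zeta>' n))
      = of_real (if blinfun_apply p (\<zeta> n) = \<zeta> n then \<alpha> else \<beta>) * cinner (\<zeta> n) (blinfun_apply x (\<zeta> n))" for n x
    unfolding \<zeta>'_def blinfun.scaleR_right cinner_scaleR_left cinner_scaleR_right c_sq ..
  have \<zeta>'_summable: "square_summable \<zeta>'"
    unfolding square_summable_def
  proof (rule summable_comparison_test'[where N = 0])
    show "summable (\<lambda>n. (\<alpha> + \<beta>) * (norm (\<zeta> n))\<^sup>2)"
      using \<zeta>(1) unfolding square_summable_def by (rule summable_mult)
    show "norm ((norm (\<zeta>' n))\<^sup>2) \<le> (\<alpha> + \<beta>) * (norm (\<zeta> n))\<^sup>2" for n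
    proof -
      have "(c n)\<^sup>2 \<le> \<alpha> + \<beta>"
        using \<alpha>(1) \<beta>(1) by (simp add: c_def)
      then have "(c n)\<^sup>2 * (norm (\<zeta> n))\<^sup>2 \<le> (\<alpha> + \<beta>) * (norm (\<zeta> n))\<^sup>2"
        by (intro mult_right_mono) simp_all
      then show ?thesis
        by (simp add: \<zeta>'_def power_mult_distrib)
    qed
  qed
  have \<zeta>'_sep: "separating M \<zeta>'"
    unfolding separating_def
  proof (intro ballI impI)
    fix x
    assume x: "x \<in> M" and zero: "\<forall>n. blinfun_apply x (\<zeta>' n) = 0"
    have "blinfun_apply x (\<zeta> n) = 0" for n
      using zero[rule_format, of n] c_pos[of n] by (simp add: \<zeta>'_def blinfun.scaleR_right)
    then show "x = 0"
      using \<zeta>(2) x unfolding separating_def by blast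
  qed
  define \<psi> where "\<psi> = vector_functional \<zeta>' \<zeta>'"
  have B_comm: "B (x o\<^sub>L p) = B (p o\<^sub>L x)" for x
  proof -
    have "cinner (\<zeta> n) (blinfun_apply (x o\<^sub>L p) (\<zeta> n)) = cinner (\<zeta> n) (blinfun_apply (p o\<^sub>L x) (\<zeta> n))" for n
      using split[of n] p_sym[of "\<zeta> n" "blinfun_apply x (\<zeta> n)"] by (auto simp: blinfun.zero_right)
    then show ?thesis
      by (simp add: B_def vector_functional_def)
  qed
  have \<psi>_p: "\<psi> (x o\<^sub>L p) = of_real \<alpha> * B (x o\<^sub>L p)" for x
    unfolding \<psi>_def
  proof (rule vector_functional_eqI[OF \<zeta>'_summable \<zeta>'_summable])
    have eq: "cinner (\<zeta>' n) (blinfun_apply (x o\<^sub>L p) (\<zeta>' n)) = of_real \<alpha> * cinner (\<zeta> n) (blinfun_apply (x o\<^sub>L p) (\<zeta> n))" for n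
      unfolding \<zeta>'_inner using split[of n] by (auto simp: blinfun.zero_right)
    show "(\<lambda>n. cinner (\<zeta>' n) (blinfun_apply (x o\<^sub>L p) (\<zeta>' n))) sums (of_real \<alpha> * B (x o\<^sub>L p))"
      unfolding eq by (rule sums_mult[OF B_sums])
  qed
  have \<psi>_one: "\<psi> id_blinfun = 1"
    unfolding \<psi>_def
  proof (rule vector_functional_eqI[OF \<zeta>'_summable \<zeta>'_summable])
    have eq: "cinner (\<zeta>' n) (blinfun_apply id_blinfun (\<zeta>' n))
        = of_real \<alpha> * cinner (\<zeta> n) (blinfun_apply p (\<zeta> n))
          + of_real \<beta> * (cinner (\<zeta> n) (blinfun_apply id_blinfun (\<zeta> n)) - cinner (\<zeta> n) (blinfun_apply p (\<zeta> n)))" for n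
      unfolding \<zeta>'_inner using split[of n] by auto
    have total: "of_real \<alpha> * B p + of_real \<beta> * (B id_blinfun - B p) = 1"
    proof -
      have "of_real \<alpha> * B p + of_real \<beta> * (B id_blinfun - B p) = of_real (\<alpha> * s + \<beta> * (1 - s))"
        unfolding B_def s(1) one by simp
      then show ?thesis
        unfolding \<beta>(2) by simp
    qed
    have "(\<lambda>n. of_real \<alpha> * cinner (\<zeta> n) (blinfun_apply p (\<zeta> n))
          + of_real \<beta> * (cinner (\<zeta> n) (blinfun_apply id_blinfun (\<zeta> n)) - cinner (\<zeta> n) (blinfun_apply p (\<zeta> n))))
        sums (of_real \<alpha> * B p + of_real \<beta> * (B id_blinfun - B p))"
      by (intro sums_add sums_mult sums_diff B_sums)
    then show "(\<lambda>n. cinner (\<zeta>' n) (blinfun_apply id_blinfun (\<zeta>' n))) sums 1"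
      unfolding eq total .
  qed
  have "restrict B M \<in> normal_faithful_states M" "restrict \<psi> M \<in> normal_faithful_states M"
    unfolding B_def \<psi>_def
    using vector_state_normal_faithful[OF M \<zeta> one]
      vector_state_normal_faithful[OF M \<zeta>'_summable \<zeta>'_sep \<psi>_one[unfolded \<psi>_def]] by blast+
  then obtain u where "u \<in> unitaries M" and conj: "conj_functional M u (restrict B M) = restrict \<psi> M"
    using hom unfolding strictly_homogeneous_state_space_def by blast
  then have uM: "u \<in> M" and uu: "adj u o\<^sub>L u = id_blinfun" "u o\<^sub>L adj u = id_blinfun"
    by (simp_all add: unitaries_def)
  have uc: "u \<in> cbounded_ops"
    using vN(1) uM by blast
  have pM: "p \<in> M"
    by (rule projectionsD(1)[OF p])
  have conj_eq: "B (adj u o\<^sub>L x o\<^sub>L u) = \<psi> x" if x: "x \<in> M" for x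
  proof -
    have "adj u o\<^sub>L x o\<^sub>L u \<in> M"
      by (intro vN(4) vN(6) uM x)
    then show ?thesis
      using fun_cong[OF conj, of x] x by (simp add: conj_functional_def)
  qed
  have uu_apply: "blinfun_apply (adj u) (blinfun_apply u \<xi>) = \<xi>" "blinfun_apply u (blinfun_apply (adj u) \<xi>) = \<xi>" for \<xi>
    using blinfun_apply_blinfun_compose[of "adj u" u \<xi>] blinfun_apply_blinfun_compose[of u "adj u" \<xi>]
    unfolding uu by simp_all
  define w where "w = p o\<^sub>L u"
  have "w \<in> M"
    unfolding w_def by (intro vN(4) pM uM)
  moreover have "norm w \<le> 1"
  proof -
    have "norm w \<le> norm p * norm u"
      unfolding w_def by (rule norm_blinfun_compose)
    also have "\<dots> \<le> 1 * 1"
      by (intro mult_mono norm_projection_le_one[OF M p] norm_isometry_le_one[OF uc uu(1)]) simp_all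
    finally show ?thesis
      by simp
  qed
  moreover have "B (w o\<^sub>L adj w) = of_real s"
  proof -
    have "adj w = adj u o\<^sub>L p"
      unfolding w_def adj_compose[OF projection_cbounded[OF M p] uc] projectionsD(2)[OF p] ..
    then have "w o\<^sub>L adj w = p"
      by (intro blinfun_eqI) (simp add: w_def uu_apply projection_idempotent[OF p])
    then show ?thesis
      using s(1) by (simp add: B_def)
  qed
  moreover have "B (y o\<^sub>L w) = of_real \<alpha> * B (w o\<^sub>L y)" if y: "y \<in> M" for y
  proof -
    have "y o\<^sub>L w = adj u o\<^sub>L ((u o\<^sub>L y) o\<^sub>L p) o\<^sub>L u"
      by (rule blinfun_eqI) (simp add: w_def uu_apply)
    also have "B \<dots> = \<psi> ((u o\<^sub>L y) o\<^sub>L p)"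
      by (intro conj_eq vN(4) uM y pM)
    also have "\<dots> = of_real \<alpha> * B ((u o\<^sub>L y) o\<^sub>L p)"
      by (rule \<psi>_p)
    also have "B ((u o\<^sub>L y) o\<^sub>L p) = B (p o\<^sub>L (u o\<^sub>L y))"
      by (rule B_comm)
    also have "p o\<^sub>L (u o\<^sub>L y) = w o\<^sub>L y"
      by (rule blinfun_eqI) (simp add: w_def)
    finally show ?thesis .
  qed
  ultimately show ?thesis
    unfolding B_def by blast
qed

text \<open>Eigenvectors of a self-adjoint operator for different eigenvalues are orthogonal, here for the
  modular operator. Both eigenvalue equations, one of them after taking adjoints, relate
  \<open>B (w\<^sup>* v)\<close> to \<open>B (v w\<^sup>*)\<close>, with the different factors \<open>\<alpha>\<close> and \<open>\<beta>\<close>.\<close>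

lemma eigenoperators_orthogonal:
  assumes M: "von_neumann_algebra M" and \<zeta>: "square_summable \<zeta>"
    and v: "v \<in> M" "\<And>y. y \<in> M \<Longrightarrow> vector_functional \<zeta> \<zeta> (y o\<^sub>L v) = of_real \<alpha> * vector_functional \<zeta> \<zeta> (v o\<^sub>L y)"
    and w: "w \<in> M" "\<And>y. y \<in> M \<Longrightarrow> vector_functional \<zeta> \<zeta> (y o\<^sub>L w) = of_real \<beta> * vector_functional \<zeta> \<zeta> (w o\<^sub>L y)"
    and ne: "\<alpha> \<noteq> \<beta>"
  shows "vector_functional \<zeta> \<zeta> (adj w o\<^sub>L v) = 0"
proof -
  note vN = von_neumann_algebraD[OF M]
  let ?B = "vector_functional \<zeta> \<zeta>"
  have c: "v \<in> cbounded_ops" "w \<in> cbounded_ops"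
    using vN(1) v(1) w(1) by blast+
  have \<alpha>_eq: "?B (adj w o\<^sub>L v) = of_real \<alpha> * ?B (v o\<^sub>L adj w)"
    by (rule v(2)[OF vN(6)[OF w(1)]])
  have \<beta>_eq: "?B (adj w o\<^sub>L v) = of_real \<beta> * ?B (v o\<^sub>L adj w)"
  proof -
    have cc: "adj v o\<^sub>L w \<in> cbounded_ops" "w o\<^sub>L adj v \<in> cbounded_ops"
      using vN(1) vN(4) vN(6) v(1) w(1) by blast+
    have "adj (adj v o\<^sub>L w) = adj w o\<^sub>L v" "adj (w o\<^sub>L adj v) = v o\<^sub>L adj w"
      by (simp_all add: adj_compose adj_adj adj_cbounded_ops c)
    then have "?B (adj w o\<^sub>L v) = cnj (?B (adj v o\<^sub>L w))" "?B (v o\<^sub>L adj w) = cnj (?B (w o\<^sub>L adj v))"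
      using vector_functional_adj[OF cc(1) \<zeta>] vector_functional_adj[OF cc(2) \<zeta>] by simp_all
    then show ?thesis
      using w(2)[OF vN(6)[OF v(1)]] by simp
  qed
  from \<alpha>_eq[symmetric] \<beta>_eq have "of_real \<alpha> * ?B (v o\<^sub>L adj w) = of_real \<beta> * ?B (v o\<^sub>L adj w)"
    by (rule trans)
  then have "?B (v o\<^sub>L adj w) = 0"
    using ne by auto
  then show ?thesis
    unfolding \<alpha>_eq by simp
qed

section \<open>Nonseparability of the predual\<close>

theorem proposition4p22:
  fixes M :: "('h::chilbert_space \<Rightarrow>\<^sub>L 'h) set"
  assumes "vN_factor M"
    and "vN_sigma_finite M"
    and "\<not> isomorphic_to_complex M"
    and "strictly_homogeneous_state_space M"
  shows "\<not> separable_space (predual_norm_topology M)"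
proof
  assume separable: "separable_space (predual_norm_topology M)"
  have M: "von_neumann_algebra M" and ne: "(id_blinfun :: 'h \<Rightarrow>\<^sub>L 'h) \<noteq> 0"
    using assms(1) by (auto simp: vN_factor_def)
  note vN = von_neumann_algebraD[OF M]
  obtain p where p: "p \<in> projections M" "p \<noteq> 0" "p \<noteq> id_blinfun"
    using nontrivial_projection_exists[OF M ne assms(3)] by blast
  obtain \<zeta> where \<zeta>: "separating M \<zeta>" "square_summable \<zeta>" and unit: "(\<Sum>n. (norm (\<zeta> n))\<^sup>2) = 1"
    and split: "\<And>n. blinfun_apply p (\<zeta> n) = \<zeta> n \<or> blinfun_apply p (\<zeta> n) = 0"
    using adapted_separating_sequence[OF M assms(2) p(1) ne] by metis
  define B where "B = vector_functional \<zeta> \<zeta>"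
  have B_proj: "B q = of_real (\<Sum>n. (norm (blinfun_apply q (\<zeta> n)))\<^sup>2)" if q: "q \<in> projections M" for q
    using vector_functional_adj_compose(2)[OF projection_cbounded[OF M q] \<zeta>(2)]
    unfolding B_def projectionsD(2,3)[OF q] .
  define s where "s = (\<Sum>n. (norm (blinfun_apply p (\<zeta> n)))\<^sup>2)"
  define t where "t = (\<Sum>n. (norm (blinfun_apply (id_blinfun - p) (\<zeta> n)))\<^sup>2)"
  have id_proj: "id_blinfun \<in> projections M"
  proof -
    have "adj id_blinfun = (id_blinfun :: 'h \<Rightarrow>\<^sub>L 'h)"
      by (rule adj_unique) simp
    moreover have "id_blinfun o\<^sub>L id_blinfun = (id_blinfun :: 'h \<Rightarrow>\<^sub>L 'h)"
      by (rule blinfun_eqI) simp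
    ultimately show ?thesis
      using vN(2) unfolding projections_def by blast
  qed
  have B_one: "B id_blinfun = 1"
    using B_proj[OF id_proj] unit by simp
  have q: "id_blinfun - p \<in> projections M"
    by (rule complementary_projection[OF M p(1)])
  have "s > 0"
    unfolding s_def by (rule separating_sum_pos[OF M projectionsD(1)[OF p(1)] p(2) \<zeta>(2,1)])
  have "t > 0"
    unfolding t_def using p(3) by (intro separating_sum_pos[OF M projectionsD(1)[OF q] _ \<zeta>(2,1)]) simp
  have "B (p + (id_blinfun - p)) = B p + B (id_blinfun - p)"
    unfolding B_def by (rule vector_functional_add[OF \<zeta>(2,2)])
  then have "complex_of_real 1 = of_real (s + t)"
    using B_one B_proj[OF p(1)] B_proj[OF q] by (simp add: s_def t_def)
  then have "s + t = 1"
    unfolding of_real_eq_iff by simp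
  then have "s < 1"
    using \<open>t > 0\<close> by simp
  let ?I = "{1/2<..<1 :: real}"
  have "\<exists>w\<in>M. norm w \<le> 1 \<and> B (w o\<^sub>L adj w) = of_real s \<and> (\<forall>y\<in>M. B (y o\<^sub>L w) = of_real \<alpha> * B (w o\<^sub>L y))"
    if \<alpha>: "\<alpha> \<in> ?I" for \<alpha>
  proof -
    have "\<alpha> * s < 1 * 1"
      using \<alpha> \<open>s < 1\<close> \<open>s > 0\<close> by (intro mult_strict_mono) auto
    then show ?thesis
      unfolding B_def using \<alpha> \<open>s < 1\<close> B_one B_proj[OF p(1)]
      by (intro eigenoperator_exists[OF M assms(4) p(1) \<zeta>(2,1) split]) (auto simp: B_def s_def)
  qed
  then obtain w where wM: "\<And>\<alpha>. \<alpha> \<in> ?I \<Longrightarrow> w \<alpha> \<in> M" and w_norm: "\<And>\<alpha>. \<alpha> \<in> ?I \<Longrightarrow> norm (w \<alpha>) \<le> 1"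
    and w_s: "\<And>\<alpha>. \<alpha> \<in> ?I \<Longrightarrow> B (w \<alpha> o\<^sub>L adj (w \<alpha>)) = of_real s"
    and w_eigen: "\<And>\<alpha> y. \<alpha> \<in> ?I \<Longrightarrow> y \<in> M \<Longrightarrow> B (y o\<^sub>L w \<alpha>) = of_real \<alpha> * B (w \<alpha> o\<^sub>L y)"
    by metis
  define f where "f = (\<lambda>\<alpha>. restrict (vector_functional (\<lambda>n. blinfun_apply (w \<alpha>) (\<zeta> n)) \<zeta>) M)"
  have wc: "w \<alpha> \<in> cbounded_ops" if "\<alpha> \<in> ?I" for \<alpha>
    using wM[OF that] vN(1) by blast
  have f_eq: "f \<alpha> x = B (adj (w \<alpha>) o\<^sub>L x)" if "\<alpha> \<in> ?I" "x \<in> M" for \<alpha> x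
    using that by (simp add: f_def B_def vector_functional_def cinner_adj_right wc)
  have f_predual: "f \<alpha> \<in> predual M" if "\<alpha> \<in> ?I" for \<alpha>
    unfolding f_def
    by (intro vector_functional_in_predual[OF M _ \<zeta>(2)])
       (simp add: square_summable_def vector_functional_adj_compose(1)[OF wc[OF that] \<zeta>(2)])
  have f_dist: "s / 2 \<le> predual_dist M (f \<alpha>) (f \<beta>)" if \<alpha>: "\<alpha> \<in> ?I" and \<beta>: "\<beta> \<in> ?I" and "\<alpha> \<noteq> \<beta>" for \<alpha> \<beta>
  proof -
    have "f \<alpha> (w \<alpha>) = of_real (\<alpha> * s)"
      unfolding f_eq[OF \<alpha> wM[OF \<alpha>]] w_eigen[OF \<alpha> vN(6)[OF wM[OF \<alpha>]]] w_s[OF \<alpha>] by simp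
    moreover have "f \<beta> (w \<alpha>) = 0"
      unfolding f_eq[OF \<beta> wM[OF \<alpha>]] B_def
      by (rule eigenoperators_orthogonal[OF M \<zeta>(2) wM[OF \<alpha>] w_eigen[OF \<alpha>, unfolded B_def]
            wM[OF \<beta>] w_eigen[OF \<beta>, unfolded B_def] \<open>\<alpha> \<noteq> \<beta>\<close>])
    ultimately have "cmod (f \<alpha> (w \<alpha>) - f \<beta> (w \<alpha>)) = \<bar>\<alpha> * s\<bar>"
      by (simp only: diff_zero norm_of_real)
    moreover have "s / 2 \<le> \<bar>\<alpha> * s\<bar>"
      using mult_right_mono[of "1/2" \<alpha> s] \<alpha> \<open>s > 0\<close> by simp
    ultimately show ?thesis
      using predual_dist_ge[OF M f_predual[OF \<alpha>] f_predual[OF \<beta>] wM[OF \<alpha>] w_norm[OF \<alpha>]] by linarith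
  qed
  interpret Metric_space "predual M" "predual_dist M"
    by (rule Metric_space_predual[OF M])
  have "countable ?I"
    using separable f_predual f_dist \<open>s > 0\<close>
    unfolding predual_norm_topology_def by (intro countable_if_uniformly_separated[of ?I f "s / 2"]) auto
  then show False
    using uncountable_open_interval[of "1/2" 1] by simp
qed

end
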